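(* Suppose $p$ is split. There are several cases: \begin{itemize} \item ($b = 0, c = 0$.) The admissible $m \in \mathbf{M}$ are then of the form $\begin{pmatrix} p^a & \beta & \gamma_1 \\ & 1 & 0 \\ & & 1\end{pmatrix}$, where $\beta^2 \equiv D \pmod {p^a}$. The cumulative measure for such an $m$ is $B(m)=p^a$. \item ($b = 0, a = c, a \ge 1$.) The admissible $m \in \mathbf{M}$ are then of the form $\begin{pmatrix} p^a & 0 & \gamma_1 \\ & 1 & 0 \\ & & p^a\end{pmatrix}$, where $p \nmid \gamma_1$. The cumulative measure for such an $m$ is $B(m)=p^{2a}$. \item ($a = c \ge b \ge 1$.) The admissible $m \in \mathbf{M}$ are then of the form $\begin{pmatrix} p^a & 0 & \gamma_1 \\ & p^b & \gamma_2 \\ & & p^a\end{pmatrix}$, where $(\gamma_1,p)= (\gamma_2,p) = 1$, and $(\gamma_1\cdot\gamma_2^{-1})^2 \equiv D \pmod {p^b}$. The cumulative measure for such an $m$ is $B(m)=p^{2a+2b}$. \item ($a > c =b \geq 1$.) Define $\beta' = p^{-c}\beta$. The admissible $m \in \mathbf{M}$ are then of the form $\begin{pmatrix} p^a & \beta & \gamma_1 \\ & p^c & \gamma_2 \\ & & p^c\end{pmatrix}$, where $p^c \mid \beta$, $(\gamma_1,p) = (\gamma_2,p) = 1$, $(\gamma_1\cdot\gamma_2^{-1})^2 \equiv D \pmod{p^c}$, $(\beta')^2 \equiv D \pmod{p^{a-c}}$, and $\beta' + (\gamma_1\cdot\gamma_2^{-1}) \equiv 0 \pmod{p^{\min{(a-c,c)}}}$.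 The cumulative measure for such an $m$ is $B(m)=p^{a+3c}$. \end{itemize}
   Context: $p\nmid 2D$ split in $L=\mathbf Q(\sqrt D)$. $\mathbf M$ is the set of matrices $m=\begin{pmatrix}p^a&\beta&\gamma_1\\0&p^b&\gamma_2\\0&0&p^c\end{pmatrix}$ with $\beta,\gamma_1\in[0,p^a-1]$, $\gamma_2\in[0,p^b-1]$, $a\ge c$, $p^c\mid\beta$. Write $y=\begin{pmatrix}p^a&\beta\\0&p^b\end{pmatrix}$. $U_m$ is the group of symmetric $u\in M_2(\mathbf Q_p)$ with $uy\in M_2(\mathbf Z_p)$ and $(\gamma_1,\gamma_2)uy\in p^c\mathbf Z_p\oplus p^{\min(b,c)}\mathbf Z_p$. $\chi(u)=\psi(-Du_{11}+u_{22})$ with $\psi$ unramified. $m$ is admissible if right $\mathrm{GL}_3(\mathbf Z_p)$-equivalent to an element $m\in\mathbf M$ with $U_m\subseteq\ker\chi$, with cumulative measure $B(m)=p^{2c+\min(b,c)}\mathrm{meas}(U_m)$. Here $\gamma_2^{-1}$ denotes the inverse of $\gamma_2$ in $\mathbf Z/p^b\mathbf Z$ (entries are viewed modulo $p^a$ or $p^b$). *)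

theory Defs
  imports
    "HOL-Analysis.Analysis"
    "HOL-Algebra.Ideal_Product"
    "HOL-Number_Theory.Modular_Inverse"
    "HOL-Computational_Algebra.Fraction_Field"
    "Berlekamp_Zassenhaus.Finite_Field"
begin

section \<open>The ring of p-adic integers and the field of p-adic numbers\<close>

text \<open>
  The prime \<open>p\<close> is the cardinality of the index type \<open>'p\<close>.  The ring of \<open>p\<close>-adic integers is the
  inverse limit of the rings of integers modulo \<open>p ^ n\<close>; a compatible sequence is stored through
  its representatives in \<open>{0..<p ^ n}\<close>.
\<close>

typedef (overloaded) ('p::prime_card) padic_int =
  "{f :: nat \<Rightarrow> int. \<forall>n. f n \<in> {0..<int CARD('p) ^ n} \<and> f (Suc n) mod int CARD('p) ^ n = f n}"
proof -
  have "0 < int CARD('p)"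
    using prime_card[where 'a='p] by (simp add: prime_gt_0_nat)
  then show ?thesis
    by (intro exI[of _ "\<lambda>_. 0"]) simp
qed

setup_lifting type_definition_padic_int

lemma card_gt_1: "1 < int CARD('p::prime_card)"
  using prime_card[where 'a='p] prime_gt_1_nat by auto

lemma padic_compatible_mod:
  fixes g :: "nat \<Rightarrow> int"
  assumes "[g (Suc n) = g n] (mod int CARD('p::prime_card) ^ n)"
  shows "g n mod int CARD('p) ^ n \<in> {0..<int CARD('p) ^ n} \<and>
    (g (Suc n) mod int CARD('p) ^ Suc n) mod int CARD('p) ^ n = g n mod int CARD('p) ^ n"
  using assms card_gt_1[where 'p='p]
  by (auto simp: cong_def mod_mod_cancel)

lemma padic_int_cong:
  assumes "\<And>n. f n \<in> {0..<int CARD('p::prime_card) ^ n} \<and> f (Suc n) mod int CARD('p) ^ n = f n"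
  shows "[f (Suc n) = f n] (mod int CARD('p) ^ n)"
  using assms[of n] by (metis cong_def mod_mod_trivial)

lemma padic_int_mod_self:
  assumes "\<And>n. f n \<in> {0..<int CARD('p::prime_card) ^ n} \<and> f (Suc n) mod int CARD('p) ^ n = f n"
  shows "f n mod int CARD('p) ^ n = f n"
  using assms[of n] by (metis atLeastLessThan_iff mod_pos_pos_trivial)

lemma padic_int_mod_le:
  assumes "\<And>n. f n \<in> {0..<int CARD('p::prime_card) ^ n} \<and> f (Suc n) mod int CARD('p) ^ n = f n"
    and "m \<le> n"
  shows "f n mod int CARD('p) ^ m = f m"
  using \<open>m \<le> n\<close>
proof (induction n rule: dec_induct)
  case base
  then show ?case using padic_int_mod_self[OF assms(1)] .
next
  case (step n)
  have "f (Suc n) mod int CARD('p) ^ m = (f (Suc n) mod int CARD('p) ^ n) mod int CARD('p) ^ m"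
    using step.hyps by (simp add: mod_mod_cancel le_imp_power_dvd)
  also have "\<dots> = f m"
    using assms(1)[of n] step.IH by simp
  finally show ?case .
qed

instantiation padic_int :: (prime_card) comm_ring_1
begin

lift_definition zero_padic_int :: "'a padic_int" is "\<lambda>_. 0"
  using card_gt_1[where 'p='a] by simp

lift_definition one_padic_int :: "'a padic_int" is "\<lambda>n. 1 mod int CARD('a) ^ n"
  by (rule padic_compatible_mod) simp

lift_definition plus_padic_int :: "'a padic_int \<Rightarrow> 'a padic_int \<Rightarrow> 'a padic_int"
  is "\<lambda>f g n. (f n + g n) mod int CARD('a) ^ n"
  by (rule padic_compatible_mod) (intro cong_add padic_int_cong)

lift_definition uminus_padic_int :: "'a padic_int \<Rightarrow> 'a padic_int"
  is "\<lambda>f n. (- f n) mod int CARD('a) ^ n"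
  by (rule padic_compatible_mod) (simp add: cong_minus_minus_iff padic_int_cong)

lift_definition minus_padic_int :: "'a padic_int \<Rightarrow> 'a padic_int \<Rightarrow> 'a padic_int"
  is "\<lambda>f g n. (f n - g n) mod int CARD('a) ^ n"
  by (rule padic_compatible_mod) (intro cong_diff padic_int_cong)

lift_definition times_padic_int :: "'a padic_int \<Rightarrow> 'a padic_int \<Rightarrow> 'a padic_int"
  is "\<lambda>f g n. (f n * g n) mod int CARD('a) ^ n"
  by (rule padic_compatible_mod) (intro cong_mult padic_int_cong)

instance
proof
  fix a b c :: "'a padic_int"
  show "a * b * c = a * (b * c)"
    by transfer (simp add: fun_eq_iff mod_simps ac_simps)
  show "a * b = b * a"
    by transfer (simp add: ac_simps)
  show "1 * a = a"
    by transfer (simp add: fun_eq_iff mod_simps padic_int_mod_self)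
  show "a + b + c = a + (b + c)"
    by transfer (simp add: fun_eq_iff mod_simps ac_simps)
  show "a + b = b + a"
    by transfer (simp add: ac_simps)
  show "0 + a = a"
    by transfer (simp add: fun_eq_iff padic_int_mod_self)
  show "- a + a = 0"
    by transfer (simp add: fun_eq_iff mod_simps)
  show "a - b = a + - b"
    by transfer (simp add: fun_eq_iff mod_simps)
  show "(a + b) * c = a * c + b * c"
    by transfer (simp add: fun_eq_iff mod_simps algebra_simps)
  show "(0::'a padic_int) \<noteq> 1"
  proof transfer
    have "1 mod int CARD('a) ^ 1 \<noteq> 0"
      using card_gt_1[where 'p='a] by simp
    then show "(\<lambda>_. 0) \<noteq> (\<lambda>n. 1 mod int CARD('a) ^ n)"
      by metis
  qed
qed

end

instance padic_int :: (prime_card) idom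
proof
  fix a b :: "'a padic_int"
  assume "a \<noteq> 0" "b \<noteq> 0"
  then show "a * b \<noteq> 0"
  proof transfer
    fix f g :: "nat \<Rightarrow> int"
    let ?p = "int CARD('a)"
    assume "\<forall>n. f n \<in> {0..<?p ^ n} \<and> f (Suc n) mod ?p ^ n = f n"
      and "\<forall>n. g n \<in> {0..<?p ^ n} \<and> g (Suc n) mod ?p ^ n = g n"
      and "f \<noteq> (\<lambda>_. 0)" "g \<noteq> (\<lambda>_. 0)"
    then have f: "\<And>n. f n \<in> {0..<?p ^ n} \<and> f (Suc n) mod ?p ^ n = f n"
      and g: "\<And>n. g n \<in> {0..<?p ^ n} \<and> g (Suc n) mod ?p ^ n = g n"
      and "\<exists>i. f i \<noteq> 0" "\<exists>j. g j \<noteq> 0"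
      by auto
    then obtain i j where ij: "f i \<noteq> 0" "g j \<noteq> 0"
      by blast
    have p: "prime ?p"
      using prime_card[where 'a='a] by simp
    show "(\<lambda>n. (f n * g n) mod ?p ^ n) \<noteq> (\<lambda>_. 0)"
    proof
      assume "(\<lambda>n. (f n * g n) mod ?p ^ n) = (\<lambda>_. 0)"
      then have dvd: "?p ^ (i + j) dvd f (i + j) * g (i + j)"
        by (metis mod_0_imp_dvd)
      have nf: "\<not> ?p ^ i dvd f (i + j)" and ng: "\<not> ?p ^ j dvd g (i + j)"
        using ij padic_int_mod_le[OF f, of i "i + j"] padic_int_mod_le[OF g, of j "i + j"]
        by (auto simp: dvd_eq_mod_eq_0)
      then have nz: "f (i + j) \<noteq> 0" "g (i + j) \<noteq> 0" by auto
      have "multiplicity ?p (f (i + j)) < i" "multiplicity ?p (g (i + j)) < j"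
        using nf ng by (meson multiplicity_dvd' not_le)+
      moreover have "i + j \<le> multiplicity ?p (f (i + j) * g (i + j))"
        using dvd nz p by (intro multiplicity_geI) (auto simp: not_prime_unit)
      ultimately show False
        using nz p by (simp add: prime_elem_multiplicity_mult_distrib)
    qed
  qed
qed

text \<open>The copy of the fraction field keeps the topology below away from the general type \<open>fract\<close>.\<close>

typedef (overloaded) ('p::prime_card) padic = "UNIV :: 'p padic_int fract set" ..

setup_lifting type_definition_padic

instantiation padic :: (prime_card) field
begin

lift_definition zero_padic :: "'a padic" is 0 .
lift_definition one_padic :: "'a padic" is 1 .
lift_definition plus_padic :: "'a padic \<Rightarrow> 'a padic \<Rightarrow> 'a padic" is "(+)" .
lift_definition uminus_padic :: "'a padic \<Rightarrow> 'a padic" is uminus .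
lift_definition minus_padic :: "'a padic \<Rightarrow> 'a padic \<Rightarrow> 'a padic" is "(-)" .
lift_definition times_padic :: "'a padic \<Rightarrow> 'a padic \<Rightarrow> 'a padic" is "(*)" .
lift_definition inverse_padic :: "'a padic \<Rightarrow> 'a padic" is inverse .
lift_definition divide_padic :: "'a padic \<Rightarrow> 'a padic \<Rightarrow> 'a padic" is "(/)" .

instance
  by standard (transfer; simp add: algebra_simps divide_inverse)+

end

definition of_padic_int :: "'p::prime_card padic_int \<Rightarrow> 'p padic" where
  "of_padic_int x = Abs_padic (Fract x 1)"

definition padic_integers :: "'p::prime_card padic set" where
  "padic_integers = range of_padic_int"

text \<open>The \<open>p\<close>-adic topology: the balls \<open>x + p ^ n \<int>\<^sub>p\<close> form a basis of neighbourhoods of \<open>x\<close>.\<close>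

instantiation padic :: (prime_card) topological_space
begin

definition open_padic :: "'a padic set \<Rightarrow> bool" where
  "open_padic S \<longleftrightarrow>
    (\<forall>x\<in>S. \<exists>n. \<forall>z\<in>padic_integers. x + of_nat CARD('a) ^ n * z \<in> S)"

instance
proof
  show "open (UNIV :: 'a padic set)"
    by (simp add: open_padic_def)
next
  fix S T :: "'a padic set"
  assume S: "open S" and T: "open T"
  have of_padic_int_mult: "of_padic_int (u * v) = of_padic_int u * of_padic_int v"
    for u v :: "'a padic_int"
    by (simp add: of_padic_int_def plus_padic.abs_eq times_padic.abs_eq eq_onp_same_args)
  have of_padic_int_1: "of_padic_int 1 = (1 :: 'a padic)"
    by (simp add: of_padic_int_def one_padic_def One_fract_def)
  have of_padic_int_add: "of_padic_int (u + v) = of_padic_int u + of_padic_int v"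
    for u v :: "'a padic_int"
    by (simp add: of_padic_int_def plus_padic.abs_eq times_padic.abs_eq eq_onp_same_args)
  have of_padic_int_0: "of_padic_int 0 = (0 :: 'a padic)"
    by (simp add: of_padic_int_def zero_padic_def Zero_fract_def)
  have of_padic_int_nat: "of_padic_int (of_nat k) = (of_nat k :: 'a padic)" for k
    by (induction k) (simp_all add: of_padic_int_add of_padic_int_0 of_padic_int_1)
  have scale: "of_nat CARD('a) ^ k * z \<in> padic_integers"
    if z: "z \<in> (padic_integers :: 'a padic set)" for k z
  proof -
    obtain w where w: "z = of_padic_int w"
      using z by (auto simp: padic_integers_def)
    have "of_nat CARD('a) ^ k * z = of_padic_int (of_nat (CARD('a) ^ k) * w)"
      by (simp only: w of_padic_int_mult of_padic_int_nat of_nat_power [symmetric])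
    then show ?thesis
      by (simp add: padic_integers_def)
  qed
  show "open (S \<inter> T)"
    unfolding open_padic_def
  proof
    fix x assume x: "x \<in> S \<inter> T"
    obtain k where k: "\<And>z. z \<in> padic_integers \<Longrightarrow> x + of_nat CARD('a) ^ k * z \<in> S"
      using S x unfolding open_padic_def by blast
    obtain l where l: "\<And>z. z \<in> padic_integers \<Longrightarrow> x + of_nat CARD('a) ^ l * z \<in> T"
      using T x unfolding open_padic_def by blast
    show "\<exists>n. \<forall>z\<in>padic_integers. x + of_nat CARD('a) ^ n * z \<in> S \<inter> T"
    proof (intro exI ballI IntI)
      fix z :: "'a padic" assume z: "z \<in> padic_integers"
      show "x + of_nat CARD('a) ^ (k + l) * z \<in> S"
        using k[OF scale[OF z, of l]] by (simp add: power_add mult.assoc)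
      show "x + of_nat CARD('a) ^ (k + l) * z \<in> T"
        using l[OF scale[OF z, of k]] by (simp add: power_add mult_ac)
    qed
  qed
next
  fix K :: "'a padic set set"
  assume "\<forall>S\<in>K. open S"
  then show "open (\<Union>K)"
    unfolding open_padic_def by (meson UnionE UnionI)
qed

end


section \<open>Unramified characters, Haar measure, splitting\<close>

text \<open>An additive character is unramified if its conductor is the ring of \<open>p\<close>-adic integers.\<close>

definition additive_character :: "('p::prime_card padic \<Rightarrow> complex) \<Rightarrow> bool" where
  "additive_character \<psi> \<longleftrightarrow>
    continuous_on UNIV \<psi> \<and> (\<forall>x. norm (\<psi> x) = 1) \<and> (\<forall>x y. \<psi> (x + y) = \<psi> x * \<psi> y)"

definition unramified_character :: "('p::prime_card padic \<Rightarrow> complex) \<Rightarrow> bool" where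
  "unramified_character \<psi> \<longleftrightarrow> additive_character \<psi> \<and>
    (\<forall>x\<in>padic_integers. \<psi> x = 1) \<and> (\<exists>x\<in>padic_integers. \<psi> (x / of_nat CARD('p)) \<noteq> 1)"

definition integral_matrix :: "'p::prime_card padic ^ 'n ^ 'm \<Rightarrow> bool" where
  "integral_matrix A \<longleftrightarrow> (\<forall>i j. A $ i $ j \<in> padic_integers)"

definition symmetric_matrices :: "('p::prime_card padic ^ 2 ^ 2) set" where
  "symmetric_matrices = {u. transpose u = u}"

text \<open>
  The Haar measure of the additive group of symmetric matrices, normalized so that the integral
  symmetric matrices have measure 1.
\<close>

definition normalized_haar :: "('p::prime_card padic ^ 2 ^ 2) measure \<Rightarrow> bool" where
  "normalized_haar \<mu> \<longleftrightarrow>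
    space \<mu> = symmetric_matrices \<and>
    sets \<mu> = sets (restrict_space borel symmetric_matrices) \<and>
    (\<forall>s\<in>symmetric_matrices. \<forall>A\<in>sets \<mu>. emeasure \<mu> ((+) s ` A) = emeasure \<mu> A) \<and>
    emeasure \<mu> {u \<in> symmetric_matrices. integral_matrix u} = 1"

definition quadratic_field :: "int \<Rightarrow> complex set" where
  "quadratic_field D = {x + y * csqrt (of_int D) | x y. x \<in> \<rat> \<and> y \<in> \<rat>}"

definition quadratic_integers :: "int \<Rightarrow> complex ring" where
  "quadratic_integers D =
    \<lparr>carrier = {z \<in> quadratic_field D. algebraic_int z}, mult = (*), one = 1, zero = 0, add = (+)\<rparr>"

definition splits_in_quadratic_field :: "nat \<Rightarrow> int \<Rightarrow> bool" where
  "splits_in_quadratic_field p D \<longleftrightarrow>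
    (\<exists>P Q. primeideal P (quadratic_integers D) \<and> primeideal Q (quadratic_integers D) \<and> P \<noteq> Q \<and>
      cgenideal (quadratic_integers D) (of_nat p) = ideal_prod (quadratic_integers D) P Q)"


section \<open>Admissible matrices\<close>

text \<open>
  An element of the set \<open>\<^bold>M\<close> is given by its exponents \<open>a b c\<close> and its entries \<open>\<beta> \<gamma>\<^sub>1 \<gamma>\<^sub>2\<close>.
\<close>

definition M_matrix ::
  "nat \<Rightarrow> nat \<Rightarrow> nat \<Rightarrow> int \<Rightarrow> int \<Rightarrow> int \<Rightarrow> 'p::prime_card padic ^ 3 ^ 3" where
  "M_matrix a b c \<beta> \<gamma>\<^sub>1 \<gamma>\<^sub>2 = vector
    [vector [of_nat CARD('p) ^ a, of_int \<beta>,             of_int \<gamma>\<^sub>1],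
     vector [0,                   of_nat CARD('p) ^ b, of_int \<gamma>\<^sub>2],
     vector [0,                   0,                   of_nat CARD('p) ^ c]]"

definition M_range :: "int \<Rightarrow> nat \<Rightarrow> nat \<Rightarrow> nat \<Rightarrow> int \<Rightarrow> int \<Rightarrow> int \<Rightarrow> bool" where
  "M_range p a b c \<beta> \<gamma>\<^sub>1 \<gamma>\<^sub>2 \<longleftrightarrow>
    \<beta> \<in> {0..p ^ a - 1} \<and> \<gamma>\<^sub>1 \<in> {0..p ^ a - 1} \<and> \<gamma>\<^sub>2 \<in> {0..p ^ b - 1} \<and> c \<le> a \<and> p ^ c dvd \<beta>"

definition y_matrix :: "nat \<Rightarrow> nat \<Rightarrow> int \<Rightarrow> 'p::prime_card padic ^ 2 ^ 2" where
  "y_matrix a b \<beta> = vector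
    [vector [of_nat CARD('p) ^ a, of_int \<beta>],
     vector [0,                   of_nat CARD('p) ^ b]]"

definition U_group ::
  "nat \<Rightarrow> nat \<Rightarrow> nat \<Rightarrow> int \<Rightarrow> int \<Rightarrow> int \<Rightarrow> ('p::prime_card padic ^ 2 ^ 2) set" where
  "U_group a b c \<beta> \<gamma>\<^sub>1 \<gamma>\<^sub>2 = {u \<in> symmetric_matrices.
    integral_matrix (u ** y_matrix a b \<beta>) \<and>
    (let w = vector [of_int \<gamma>\<^sub>1, of_int \<gamma>\<^sub>2] v* (u ** y_matrix a b \<beta>) in
      w $ 1 \<in> (*) (of_nat CARD('p) ^ c) ` padic_integers \<and>
      w $ 2 \<in> (*) (of_nat CARD('p) ^ min b c) ` padic_integers)}"

definition chi :: "int \<Rightarrow> ('p::prime_card padic \<Rightarrow> complex) \<Rightarrow> 'p padic ^ 2 ^ 2 \<Rightarrow> complex" where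
  "chi D \<psi> u = \<psi> (- of_int D * u $ 1 $ 1 + u $ 2 $ 2)"

definition right_equivalent :: "'p::prime_card padic ^ 3 ^ 3 \<Rightarrow> 'p padic ^ 3 ^ 3 \<Rightarrow> bool" where
  "right_equivalent m m' \<longleftrightarrow>
    (\<exists>k :: 'p padic_int ^ 3 ^ 3. invertible k \<and> m' = m ** (\<chi> i j. of_padic_int (k $ i $ j)))"

definition admissible ::
  "int \<Rightarrow> ('p::prime_card padic \<Rightarrow> complex) \<Rightarrow> 'p padic ^ 3 ^ 3 \<Rightarrow> bool" where
  "admissible D \<psi> m \<longleftrightarrow>
    (\<exists>a b c \<beta> \<gamma>\<^sub>1 \<gamma>\<^sub>2. M_range (int CARD('p)) a b c \<beta> \<gamma>\<^sub>1 \<gamma>\<^sub>2 \<and>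
      right_equivalent m (M_matrix a b c \<beta> \<gamma>\<^sub>1 \<gamma>\<^sub>2) \<and>
      U_group a b c \<beta> \<gamma>\<^sub>1 \<gamma>\<^sub>2 \<subseteq> {u. chi D \<psi> u = 1})"

definition cumulative_measure ::
  "('p::prime_card padic ^ 2 ^ 2) measure \<Rightarrow> nat \<Rightarrow> nat \<Rightarrow> nat \<Rightarrow> int \<Rightarrow> int \<Rightarrow> int \<Rightarrow> real" where
  "cumulative_measure \<mu> a b c \<beta> \<gamma>\<^sub>1 \<gamma>\<^sub>2 =
    real CARD('p) ^ (2 * c + min b c) * measure \<mu> (U_group a b c \<beta> \<gamma>\<^sub>1 \<gamma>\<^sub>2)"

end

theory Submission
  imports Defs
begin

text \<open>
  Write a symmetric matrix \<open>u\<close> as \<open>(r, s; s, t)\<close>, so that \<open>\<chi>(u) = \<psi>(t - D r)\<close>.  Hermite normal forms are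
  unique, and \<open>U\<^sub>m\<close> is a \<open>\<int>\<close>-module with bounded denominators, so \<open>m \<in> \<^bold>M\<close> is admissible exactly
  if \<open>t - D r\<close> is integral for all \<open>u \<in> U\<^sub>m\<close>.  Explicit elements \<open>u\<close> with entries of small denominator
  exclude the exponents outside of the four cases and force the coprimality conditions.  In the
  remaining cases \<open>U\<^sub>m\<close> is generated by the integral matrices and
  \<open>p\<^bsup>-k\<^esup>(1, -h; -h, h\<^sup>2)\<close>, \<open>p\<^bsup>-n\<^esup>(1, -g; -g, g\<^sup>2)\<close> for integers \<open>g\<close>, \<open>h\<close> with \<open>p \<nmid> g - h\<close>: in the first
  three cases \<open>k = 0\<close> and \<open>(n, g)\<close> is \<open>(a, \<beta>)\<close>, \<open>(0, 0)\<close>, \<open>(b, \<gamma>\<^sub>1 \<gamma>\<^sub>2\<inverse>)\<close>, while in the fourth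
  \<open>(k, n, g, h) = (a - c, c, \<gamma>\<^sub>1 \<gamma>\<^sub>2\<inverse>, \<beta>')\<close>.  Evaluating \<open>t - D r\<close> on the generators gives the quadratic
  congruences, and the index \<open>p\<^bsup>k + n\<^esup>\<close> of the integral matrices gives the measure.
\<close>


section \<open>Embedding of the p-adic integers, residues and divisibility\<close>

abbreviation PP :: "'p::prime_card padic" where
  "PP \<equiv> of_nat CARD('p)"

lemma of_padic_int_add: "of_padic_int (x + y) = of_padic_int x + of_padic_int y"
  by (simp add: of_padic_int_def plus_padic.abs_eq)

lemma of_padic_int_mult: "of_padic_int (x * y) = of_padic_int x * of_padic_int y"
  by (simp add: of_padic_int_def times_padic.abs_eq)

lemma of_padic_int_0 [simp]: "of_padic_int 0 = 0"
  by (simp add: of_padic_int_def zero_padic_def Zero_fract_def)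

lemma of_padic_int_1 [simp]: "of_padic_int 1 = 1"
  by (simp add: of_padic_int_def one_padic_def One_fract_def)

lemma of_padic_int_minus: "of_padic_int (- x) = - of_padic_int x"
  using of_padic_int_add[of x "- x"] by (simp add: eq_neg_iff_add_eq_0 add.commute)

lemma of_padic_int_of_nat [simp]: "of_padic_int (of_nat n) = of_nat n"
  by (induction n) (simp_all add: of_padic_int_add)

lemma of_padic_int_of_int [simp]: "of_padic_int (of_int i) = of_int i"
  by (cases i rule: int_cases2) (simp_all add: of_padic_int_minus)

lemma of_padic_int_eq_iff [simp]: "of_padic_int x = of_padic_int y \<longleftrightarrow> x = y"
  by (simp add: of_padic_int_def Abs_padic_inject eq_fract)

lemma of_padic_int_power: "of_padic_int (x ^ n) = of_padic_int x ^ n"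
  by (induction n) (simp_all add: of_padic_int_mult)

lemma of_padic_int_sum: "of_padic_int (\<Sum>i\<in>A. f i) = (\<Sum>i\<in>A. of_padic_int (f i))"
  by (induction A rule: infinite_finite_induct) (simp_all add: of_padic_int_add)

lemma Rep_padic_int_of_nat:
  "Rep_padic_int (of_nat k :: 'p::prime_card padic_int) n = int k mod int CARD('p) ^ n"
  by (induction k) (simp_all add: zero_padic_int.rep_eq one_padic_int.rep_eq
      plus_padic_int.rep_eq mod_simps)

lemma Rep_padic_int_of_int:
  "Rep_padic_int (of_int i :: 'p::prime_card padic_int) n = i mod int CARD('p) ^ n"
  by (cases i rule: int_cases2)
    (simp_all add: Rep_padic_int_of_nat uminus_padic_int.rep_eq mod_simps)

lemma Rep_padic_int_compatible:
  fixes x :: "'p::prime_card padic_int"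
  shows "Rep_padic_int x n \<in> {0..<int CARD('p) ^ n} \<and>
    Rep_padic_int x (Suc n) mod int CARD('p) ^ n = Rep_padic_int x n"
  using Rep_padic_int[of x] by simp

text \<open>If the residue at \<open>n\<close> vanishes, the quotient by \<open>p ^ n\<close> can be
  written down: it is the residue sequence shifted by \<open>n\<close> and divided by
  \<open>p ^ n\<close>.\<close>

lemma padic_int_dvd_iff:
  fixes x :: "'p::prime_card padic_int"
  shows "of_nat CARD('p) ^ n dvd x \<longleftrightarrow> Rep_padic_int x n = 0"
proof
  assume "of_nat CARD('p) ^ n dvd x"
  then obtain y where y: "x = of_nat (CARD('p) ^ n) * y"
    by (auto simp: dvd_def)
  show "Rep_padic_int x n = 0"
    unfolding y times_padic_int.rep_eq Rep_padic_int_of_nat by simp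
next
  let ?p = "int CARD('p)"
  let ?f = "Rep_padic_int x"
  assume 0: "?f n = 0"
  have p0: "?p ^ n > 0" using card_gt_1[where 'p='p] by simp
  have dvd: "?p ^ n dvd ?f (m + n)" for m
    using padic_int_mod_le[OF Rep_padic_int_compatible[of x], of n "m + n"] 0
    by (auto simp: dvd_eq_mod_eq_0)
  \<comment> \<open>The residue at \<open>m + n\<close> is known modulo \<open>p ^ (m + n)\<close>,
    so its quotient by \<open>p ^ n\<close> is known modulo \<open>p ^ m\<close>; hence the
    shift.\<close>
  define g where "g m = ?f (m + n) div ?p ^ n" for m
  have f: "?f (m + n) = ?p ^ n * g m" for m
    using dvd[of m] by (simp add: g_def)
  have "g m \<in> {0..<?p ^ m} \<and> g (Suc m) mod ?p ^ m = g m" for m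
  proof -
    have "?p ^ n * g m \<in> {0..<?p ^ n * ?p ^ m}"
      and eq: "(?p ^ n * g (Suc m)) mod (?p ^ n * ?p ^ m) = ?p ^ n * g m"
      using Rep_padic_int_compatible[of x "m + n"] f[of m] f[of "Suc m"]
      by (simp_all add: power_add mult.commute)
    then have "g m \<in> {0..<?p ^ m}"
      using p0 by (auto simp: zero_le_mult_iff)
    moreover have "g (Suc m) mod ?p ^ m = g m"
      using eq p0 by (simp add: mult_mod_right [symmetric])
    ultimately show ?thesis by simp
  qed
  then have g: "Rep_padic_int (Abs_padic_int g :: 'p padic_int) = g"
    by (intro Abs_padic_int_inverse) simp
  have "x = of_nat (CARD('p) ^ n) * Abs_padic_int g"
  proof (rule Rep_padic_int_inject[THEN iffD1], rule ext)
    fix m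
    have "?p ^ n * g m mod ?p ^ m = ?f m"
      using padic_int_mod_le[OF Rep_padic_int_compatible[of x], of m "m + n"] f[of m] by simp
    then show "?f m = Rep_padic_int (of_nat (CARD('p) ^ n) * Abs_padic_int g :: 'p padic_int) m"
      unfolding times_padic_int.rep_eq Rep_padic_int_of_nat g by (simp add: mod_simps)
  qed
  then show "of_nat CARD('p) ^ n dvd x"
    by (metis dvd_triv_left of_nat_power)
qed

lemma padic_integers_of_padic_int [simp]: "of_padic_int x \<in> padic_integers"
  by (simp add: padic_integers_def)

lemma padic_integersE:
  assumes "x \<in> padic_integers"
  obtains y where "x = of_padic_int y"
  using assms by (auto simp: padic_integers_def)

lemma padic_integers_of_int [simp]: "of_int i \<in> padic_integers"
  by (metis padic_integers_of_padic_int of_padic_int_of_int)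

lemma padic_integers_of_nat [simp]: "of_nat i \<in> padic_integers"
  by (metis padic_integers_of_padic_int of_padic_int_of_nat)

lemma padic_integers_0 [simp]: "0 \<in> padic_integers"
  using padic_integers_of_nat[of 0] by simp

lemma padic_integers_1 [simp]: "1 \<in> padic_integers"
  using padic_integers_of_nat[of 1] by simp

lemma padic_integers_add: "\<lbrakk>x \<in> padic_integers; y \<in> padic_integers\<rbrakk> \<Longrightarrow> x + y \<in> padic_integers"
  by (metis padic_integersE padic_integers_of_padic_int of_padic_int_add)

lemma padic_integers_mult: "\<lbrakk>x \<in> padic_integers; y \<in> padic_integers\<rbrakk> \<Longrightarrow> x * y \<in> padic_integers"
  by (metis padic_integersE padic_integers_of_padic_int of_padic_int_mult)

lemma padic_integers_of_int_mult: "x \<in> padic_integers \<Longrightarrow> of_int i * x \<in> padic_integers"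
  by (rule padic_integers_mult) simp_all

lemma padic_integers_minus: "x \<in> padic_integers \<Longrightarrow> - x \<in> padic_integers"
  by (metis padic_integersE padic_integers_of_padic_int of_padic_int_minus)

lemma padic_integers_diff: "\<lbrakk>x \<in> padic_integers; y \<in> padic_integers\<rbrakk> \<Longrightarrow> x - y \<in> padic_integers"
  using padic_integers_add[of x "- y"] by (simp add: padic_integers_minus)

lemma padic_integers_power: "x \<in> padic_integers \<Longrightarrow> x ^ n \<in> padic_integers"
  by (induction n) (simp_all add: padic_integers_mult)

lemma PP_nonzero [simp]: "PP \<noteq> (0 :: 'p::prime_card padic)"
proof
  assume "PP = (0 :: 'p padic)"
  then have "of_padic_int (of_nat CARD('p)) = (of_padic_int 0 :: 'p padic)"
    by simp
  then have "(of_nat CARD('p) :: 'p padic_int) = 0"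
    unfolding of_padic_int_eq_iff .
  \<comment> \<open>\<open>p\<close> vanishes modulo \<open>p ^ 1\<close>; index 2 is the first
    whose residue tells it from 0.\<close>
  then have "Rep_padic_int (of_nat CARD('p) :: 'p padic_int) 2 =
      Rep_padic_int (0 :: 'p padic_int) 2"
    by (simp only:)
  then show False
    using card_gt_1[where 'p='p]
    by (simp add: Rep_padic_int_of_nat zero_padic_int.rep_eq power2_eq_square)
qed

text \<open>Injectivity of the embedding reduces the claim to the residue of \<open>i\<close> at
  \<open>n\<close>. All congruences of the theorem are extracted from p-adic integrality in this
  way.\<close>

lemma of_int_div_PP_power_iff:
  "of_int i / PP ^ n \<in> (padic_integers :: 'p::prime_card padic set) \<longleftrightarrow> int CARD('p) ^ n dvd i"
proof -
  have "of_int i / PP ^ n \<in> (padic_integers :: 'p padic set) \<longleftrightarrow>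
      (\<exists>y. of_int i = (PP ^ n * of_padic_int y :: 'p padic))"
    unfolding padic_integers_def by (auto simp: field_simps)
  also have "\<dots> \<longleftrightarrow> (\<exists>y. of_int i = (of_nat CARD('p) ^ n * y :: 'p padic_int))"
  proof (intro iff_exI)
    fix y :: "'p padic_int"
    have "PP ^ n * of_padic_int y = of_padic_int (of_nat CARD('p) ^ n * y)"
      by (simp add: of_padic_int_mult of_padic_int_power)
    moreover have "of_int i = (of_padic_int (of_int i) :: 'p padic)"
      by simp
    ultimately show "of_int i = PP ^ n * of_padic_int y \<longleftrightarrow> of_int i = of_nat CARD('p) ^ n * y"
      by (simp only: of_padic_int_eq_iff)
  qed
  also have "\<dots> \<longleftrightarrow> int CARD('p) ^ n dvd i"
    unfolding dvd_def[symmetric] padic_int_dvd_iff Rep_padic_int_of_int by auto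
  finally show ?thesis .
qed

text \<open>The residue at \<open>n\<close> of the compatible sequence is the approximating
  integer.\<close>

lemma padic_integers_approx:
  fixes x :: "'p::prime_card padic"
  assumes "x \<in> padic_integers"
  obtains i where "0 \<le> i" "i < int CARD('p) ^ n" "(x - of_int i) / PP ^ n \<in> padic_integers"
proof -
  obtain y where y: "x = of_padic_int y" using assms by (rule padic_integersE)
  define i where "i = Rep_padic_int y n"
  have i: "0 \<le> i" "i < int CARD('p) ^ n"
    using Rep_padic_int_compatible[of y n] by (auto simp: i_def)
  then have "Rep_padic_int (y - of_int i) n = 0"
    by (simp add: minus_padic_int.rep_eq Rep_padic_int_of_int i_def[symmetric])
  then obtain z where "y - of_int i = of_nat CARD('p) ^ n * z"
    unfolding padic_int_dvd_iff[symmetric] dvd_def by blast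
  then have "y = of_nat CARD('p) ^ n * z + of_int i" by (simp only: diff_eq_eq)
  then have "x - of_int i = PP ^ n * of_padic_int z"
    by (simp add: y of_padic_int_add of_padic_int_mult of_padic_int_power)
  then have "(x - of_int i) / PP ^ n \<in> padic_integers" by simp
  then show ?thesis using i that by blast
qed

text \<open>A Bezout identity for \<open>p ^ n\<close> and \<open>i\<close> writes \<open>x\<close>
  as an integer combination of the two integral products. This replaces division by the p-adic unit
  \<open>i\<close>.\<close>

lemma padic_integers_cancel_coprime:
  fixes x :: "'p::prime_card padic"
  assumes "PP ^ n * x \<in> padic_integers" "of_int i * x \<in> padic_integers" "\<not> int CARD('p) dvd i"
  shows "x \<in> padic_integers"
proof -
  have "prime (int CARD('p))" using prime_card[where 'a='p] by simp
  then have "coprime (int CARD('p) ^ n) i"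
    using assms(3) by (simp add: prime_imp_coprime)
  then obtain u v where uv: "u * int CARD('p) ^ n + v * i = 1"
    by (metis bezout_int coprime_iff_gcd_eq_1)
  have "x = of_int (u * int CARD('p) ^ n + v * i) * x" by (simp add: uv)
  also have "\<dots> = of_int u * (PP ^ n * x) + of_int v * (of_int i * x)"
    by (simp add: algebra_simps)
  also have "\<dots> \<in> padic_integers"
    using assms by (blast intro: padic_integers_add padic_integers_mult padic_integers_of_int)
  finally show ?thesis .
qed

section \<open>Unramified characters\<close>

lemma unramified_character_add:
  "unramified_character \<psi> \<Longrightarrow> \<psi> (x + y) = \<psi> x * \<psi> y"
  by (simp add: unramified_character_def additive_character_def)

lemma unramified_character_padic_integers:
  "unramified_character \<psi> \<Longrightarrow> x \<in> padic_integers \<Longrightarrow> \<psi> x = 1"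
  by (simp add: unramified_character_def)

text \<open>Write \<open>p\<^bsup>n + 1\<^esup> x = w\<close> with \<open>p \<nmid> w\<close>.  If \<open>v w \<equiv> 1\<close> and \<open>k \<equiv> y\<close> modulo \<open>p\<close>, then
  \<open>v k p\<^sup>n x \<in> y / p + \<int>\<^sub>p\<close>, which moves \<open>x\<close> to a given element of \<open>p\<^bsup>-1\<^esup> \<int>\<^sub>p\<close>.\<close>

lemma unramified_character_nontrivial_multiple:
  fixes \<psi> :: "'p::prime_card padic \<Rightarrow> complex"
  assumes \<psi>: "unramified_character \<psi>"
    and "PP ^ n * x \<in> padic_integers" "x \<notin> padic_integers"
  shows "\<exists>i. \<psi> (of_int i * x) \<noteq> 1"
  using assms(2)
proof (induction n)
  case 0
  then show ?case using assms(3) by simp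
next
  case (Suc n)
  let ?p = "int CARD('p)"
  show ?case
  proof (cases "PP ^ n * x \<in> padic_integers")
    case True
    then show ?thesis by (rule Suc.IH)
  next
    case False
    define w where "w = PP ^ Suc n * x"
    have wZ: "w \<in> padic_integers" using Suc.prems by (simp add: w_def)
    obtain j where j: "(w - of_int j) / PP ^ 1 \<in> padic_integers"
      using wZ by (rule padic_integers_approx)
    have "\<not> ?p dvd j"
    proof
      assume "?p dvd j"
      then have "of_int j / PP ^ 1 \<in> (padic_integers :: 'p padic set)"
        unfolding of_int_div_PP_power_iff by simp
      then have "(w - of_int j) / PP ^ 1 + of_int j / PP ^ 1 \<in> padic_integers"
        by (intro padic_integers_add j)
      moreover have "(w - of_int j) / PP ^ 1 + of_int j / PP ^ 1 = PP ^ n * x"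
        by (simp add: w_def field_simps)
      ultimately show False using False by simp
    qed
    moreover have "prime ?p" using prime_card[where 'a='p] by simp
    ultimately have "coprime ?p j" by (simp add: prime_imp_coprime)
    then obtain u v where uv: "u * ?p + v * j = 1"
      by (metis bezout_int coprime_iff_gcd_eq_1)
    obtain y where y: "y \<in> padic_integers" "\<psi> (y / PP) \<noteq> 1"
      using \<psi> by (auto simp: unramified_character_def)
    obtain k where k: "(y - of_int k) / PP ^ 1 \<in> padic_integers"
      using y(1) by (rule padic_integers_approx)
    have uv': "of_int v * of_int j = (1 - of_int u * PP :: 'p padic)"
      by (metis uv add_diff_cancel_left' of_int_1 of_int_diff of_int_mult of_int_of_nat_eq)
    have "of_int (v * k * ?p ^ n) * x - y / PP =
        of_int (v * k) * ((w - of_int j) / PP ^ 1) - (y - of_int k) / PP ^ 1 +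
          of_int k * (of_int v * of_int j - 1) / PP"
      by (simp add: w_def field_simps)
    also have "of_int k * (of_int v * of_int j - 1) / PP = (- of_int (k * u) :: 'p padic)"
      unfolding uv' by simp
    finally have "of_int (v * k * ?p ^ n) * x - y / PP \<in> padic_integers"
      by (elim ssubst) (intro padic_integers_add padic_integers_diff padic_integers_mult
          padic_integers_minus padic_integers_of_int j k)
    then have "\<psi> (of_int (v * k * ?p ^ n) * x) = \<psi> (y / PP)"
      using unramified_character_add[OF \<psi>, of "of_int (v * k * ?p ^ n) * x - y / PP" "y / PP"]
      by (simp add: unramified_character_padic_integers[OF \<psi>])
    then show ?thesis using y(2) by metis
  qed
qed


section \<open>Symmetric matrices, \<open>U_group\<close> in coordinates, and the kernel of
  \<open>chi\<close>\<close>

definition sym2 :: "'a \<Rightarrow> 'a \<Rightarrow> 'a \<Rightarrow> 'a :: zero ^ 2 ^ 2" where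
  "sym2 r s t = vector [vector [r, s], vector [s, t]]"

lemma sym2_nth [simp]:
  "sym2 r s t $ 1 $ 1 = r" "sym2 r s t $ 1 $ 2 = s"
  "sym2 r s t $ 2 $ 1 = s" "sym2 r s t $ 2 $ 2 = t"
  by (simp_all add: sym2_def)

lemma sym2_eq_iff [simp]: "sym2 r s t = sym2 r' s' t' \<longleftrightarrow> r = r' \<and> s = s' \<and> t = t'"
  by (metis sym2_nth)

lemma sym2_add: "sym2 r s t + sym2 r' s' t' = sym2 (r + r') (s + s') (t + t' :: 'a :: monoid_add)"
  by (simp add: vec_eq_iff forall_2)

lemma sym2_symmetric [simp]: "sym2 r s t \<in> symmetric_matrices"
  by (simp add: symmetric_matrices_def transpose_def vec_eq_iff forall_2)

lemma symmetric_matricesE: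
  assumes "u \<in> symmetric_matrices"
  obtains r s t where "u = sym2 r s t"
proof
  have "u $ 2 $ 1 = transpose u $ 1 $ 2"
    by (simp add: transpose_def)
  also have "\<dots> = u $ 1 $ 2"
    using assms by (simp add: symmetric_matrices_def)
  finally have "u $ 2 $ 1 = u $ 1 $ 2" .
  then show "u = sym2 (u $ 1 $ 1) (u $ 1 $ 2) (u $ 2 $ 2)"
    by (simp add: vec_eq_iff forall_2)
qed

definition integral_symmetric :: "('p::prime_card padic ^ 2 ^ 2) set" where
  "integral_symmetric = {u \<in> symmetric_matrices. integral_matrix u}"

lemma sym2_in_integral_symmetric_iff:
  "sym2 r s t \<in> integral_symmetric \<longleftrightarrow>
    r \<in> padic_integers \<and> s \<in> padic_integers \<and> t \<in> padic_integers"
  by (auto simp: integral_symmetric_def integral_matrix_def forall_2)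

lemma PP_power_image_iff:
  "x \<in> (*) (PP ^ n) ` padic_integers \<longleftrightarrow> x / PP ^ n \<in> (padic_integers :: 'p::prime_card padic set)"
proof
  assume "x / PP ^ n \<in> (padic_integers :: 'p padic set)"
  moreover have "x = PP ^ n * (x / PP ^ n)" by simp
  ultimately show "x \<in> (*) (PP ^ n) ` padic_integers" by blast
qed auto

text \<open>The first four conditions come from the entries of \<open>u y\<close>, the last two from
  those of the row vector times \<open>u y\<close>.\<close>

lemma sym2_in_U_group_iff:
  fixes r s t :: "'p::prime_card padic"
  shows "sym2 r s t \<in> U_group a b c \<beta> \<gamma>\<^sub>1 \<gamma>\<^sub>2 \<longleftrightarrow>
    PP ^ a * r \<in> padic_integers \<and> PP ^ a * s \<in> padic_integers \<and>
    of_int \<beta> * r + PP ^ b * s \<in> padic_integers \<and> of_int \<beta> * s + PP ^ b * t \<in> padic_integers \<and>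
    PP ^ a * (of_int \<gamma>\<^sub>1 * r + of_int \<gamma>\<^sub>2 * s) / PP ^ c \<in> padic_integers \<and>
    (of_int \<gamma>\<^sub>1 * (of_int \<beta> * r + PP ^ b * s) + of_int \<gamma>\<^sub>2 * (of_int \<beta> * s + PP ^ b * t)) / PP ^ min b c
      \<in> padic_integers"
proof -
  have uy: "sym2 r s t ** y_matrix a b \<beta> =
      vector [vector [PP ^ a * r, of_int \<beta> * r + PP ^ b * s],
              vector [PP ^ a * s, of_int \<beta> * s + PP ^ b * t]]"
    by (simp add: vec_eq_iff forall_2 matrix_matrix_mult_def sum_2 y_matrix_def mult.commute)
  have w: "vector [of_int \<gamma>\<^sub>1, of_int \<gamma>\<^sub>2] v* (sym2 r s t ** y_matrix a b \<beta>) =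
      vector [PP ^ a * (of_int \<gamma>\<^sub>1 * r + of_int \<gamma>\<^sub>2 * s),
        of_int \<gamma>\<^sub>1 * (of_int \<beta> * r + PP ^ b * s) + of_int \<gamma>\<^sub>2 * (of_int \<beta> * s + PP ^ b * t)]"
    unfolding uy
    by (simp add: vec_eq_iff forall_2 vector_matrix_mult_def sum_2 algebra_simps)
  show ?thesis
    unfolding U_group_def mem_Collect_eq Let_def w unfolding uy
    by (auto simp: PP_power_image_iff integral_matrix_def forall_2)
qed

lemma chi_sym2: "chi D \<psi> (sym2 r s t) = \<psi> (t - of_int D * r)"
  by (simp add: chi_def)

text \<open>The kernel condition with the character removed: \<open>t - D r\<close> is the trace of
  \<open>u\<close> times diag(-D, 1), the argument of \<psi> in \<open>chi\<close>.\<close>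

definition trace_integral :: "int \<Rightarrow> ('p::prime_card padic ^ 2 ^ 2) set \<Rightarrow> bool" where
  "trace_integral D U \<longleftrightarrow> (\<forall>r s t. sym2 r s t \<in> U \<longrightarrow> t - of_int D * r \<in> padic_integers)"

text \<open>\<open>U_group\<close> is closed under integer multiples. If \<open>t - D r\<close> is
  not integral at some member, \<psi> differs from 1 at some integer multiple of it, and the same
  multiple of the member is again a member.\<close>

lemma U_group_subset_ker_chi_iff:
  fixes \<psi> :: "'p::prime_card padic \<Rightarrow> complex"
  assumes \<psi>: "unramified_character \<psi>"
  shows "U_group a b c \<beta> \<gamma>\<^sub>1 \<gamma>\<^sub>2 \<subseteq> {u. chi D \<psi> u = 1} \<longleftrightarrow>
    trace_integral D (U_group a b c \<beta> \<gamma>\<^sub>1 \<gamma>\<^sub>2 :: ('p padic ^ 2 ^ 2) set)"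
    (is "?U \<subseteq> _ \<longleftrightarrow> _")
proof
  assume sub: "?U \<subseteq> {u. chi D \<psi> u = 1}"
  show "trace_integral D ?U"
    unfolding trace_integral_def
  proof (intro allI impI, rule ccontr)
    fix r s t assume u: "sym2 r s t \<in> ?U" and x: "t - of_int D * r \<notin> padic_integers"
    have Z: "PP ^ a * r \<in> padic_integers" "PP ^ a * s \<in> padic_integers"
      "of_int \<beta> * s + PP ^ b * t \<in> padic_integers"
      using u by (simp_all add: sym2_in_U_group_iff)
    \<comment> \<open>A power of \<open>p\<close> clearing the denominators, obtained by eliminating
      \<open>s\<close> from the second column of \<open>u y\<close>.\<close>
    have "PP ^ (a + b) * (t - of_int D * r) =
        PP ^ a * (of_int \<beta> * s + PP ^ b * t) - of_int \<beta> * (PP ^ a * s)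
          - of_int (D * int CARD('p) ^ b) * (PP ^ a * r)"
      by (simp add: power_add algebra_simps)
    also have "\<dots> \<in> padic_integers"
      using Z padic_integers_of_int_mult[OF Z(1)] padic_integers_of_int_mult[OF Z(2)]
        padic_integers_of_int_mult[OF Z(3), of "int CARD('p) ^ a"]
      by (intro padic_integers_diff) (auto simp del: of_int_mult)
    finally obtain i where i: "\<psi> (of_int i * (t - of_int D * r)) \<noteq> 1"
      using unramified_character_nontrivial_multiple[OF \<psi> _ x] by blast
    have "sym2 (of_int i * r) (of_int i * s) (of_int i * t) \<in> ?U"
    proof -
      have eqs: "PP ^ a * (of_int i * r) = of_int i * (PP ^ a * r)"
        "PP ^ a * (of_int i * s) = of_int i * (PP ^ a * s)"
        "of_int \<beta> * (of_int i * r) + PP ^ b * (of_int i * s) = of_int i * (of_int \<beta> * r + PP ^ b * s)"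
        "of_int \<beta> * (of_int i * s) + PP ^ b * (of_int i * t) = of_int i * (of_int \<beta> * s + PP ^ b * t)"
        "PP ^ a * (of_int \<gamma>\<^sub>1 * (of_int i * r) + of_int \<gamma>\<^sub>2 * (of_int i * s)) / PP ^ c =
          of_int i * (PP ^ a * (of_int \<gamma>\<^sub>1 * r + of_int \<gamma>\<^sub>2 * s) / PP ^ c)"
        "(of_int \<gamma>\<^sub>1 * (of_int i * X) + of_int \<gamma>\<^sub>2 * (of_int i * Y)) / PP ^ min b c =
          of_int i * ((of_int \<gamma>\<^sub>1 * X + of_int \<gamma>\<^sub>2 * Y) / PP ^ min b c)" for X Y :: "'p padic"
        by (simp_all add: algebra_simps add_divide_distrib)
      show ?thesis
        using u unfolding sym2_in_U_group_iff eqs by (blast intro: padic_integers_of_int_mult)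
    qed
    then have "chi D \<psi> (sym2 (of_int i * r) (of_int i * s) (of_int i * t)) = 1"
      using sub by blast
    then show False
      using i by (simp add: chi_sym2 algebra_simps)
  qed
next
  assume *: "trace_integral D ?U"
  show "?U \<subseteq> {u. chi D \<psi> u = 1}"
  proof
    fix u assume u: "u \<in> ?U"
    then have "u \<in> symmetric_matrices" by (simp add: U_group_def)
    then obtain r s t where rst: "u = sym2 r s t" by (rule symmetric_matricesE)
    then show "u \<in> {u. chi D \<psi> u = 1}"
      using u * by (simp add: trace_integral_def chi_sym2 unramified_character_padic_integers[OF \<psi>])
  qed
qed

section \<open>Uniqueness of Hermite normal forms\<close>

lemma M_matrix_nth [simp]:
  "M_matrix a b c \<beta> \<gamma>\<^sub>1 \<gamma>\<^sub>2 $ 1 $ 1 = PP ^ a"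
  "M_matrix a b c \<beta> \<gamma>\<^sub>1 \<gamma>\<^sub>2 $ 1 $ 2 = of_int \<beta>"
  "M_matrix a b c \<beta> \<gamma>\<^sub>1 \<gamma>\<^sub>2 $ 1 $ 3 = of_int \<gamma>\<^sub>1"
  "M_matrix a b c \<beta> \<gamma>\<^sub>1 \<gamma>\<^sub>2 $ 2 $ 1 = 0"
  "M_matrix a b c \<beta> \<gamma>\<^sub>1 \<gamma>\<^sub>2 $ 2 $ 2 = PP ^ b"
  "M_matrix a b c \<beta> \<gamma>\<^sub>1 \<gamma>\<^sub>2 $ 2 $ 3 = of_int \<gamma>\<^sub>2"
  "M_matrix a b c \<beta> \<gamma>\<^sub>1 \<gamma>\<^sub>2 $ 3 $ 1 = 0"
  "M_matrix a b c \<beta> \<gamma>\<^sub>1 \<gamma>\<^sub>2 $ 3 $ 2 = 0"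
  "M_matrix a b c \<beta> \<gamma>\<^sub>1 \<gamma>\<^sub>2 $ 3 $ 3 = PP ^ c"
  by (simp_all add: M_matrix_def)

text \<open>Comparing entries shows \<open>K\<close> upper triangular, so the diagonal powers of
  \<open>p\<close> divide each other. If they agree, entries above the diagonal change only by
  multiples of the diagonal power in their row, and the ranges leave one representative.\<close>

lemma M_matrix_right_multiple:
  fixes K :: "'p::prime_card padic ^ 3 ^ 3"
  assumes K: "integral_matrix K"
    and eq: "M_matrix a' b' c' \<beta>' \<gamma>\<^sub>1' \<gamma>\<^sub>2' = M_matrix a b c \<beta> \<gamma>\<^sub>1 \<gamma>\<^sub>2 ** K"
  shows M_matrix_right_multiple_le: "a \<le> a'" "b \<le> b'" "c \<le> c'"
    and M_matrix_right_multiple_unique: "\<lbrakk>a' = a; b' = b; c' = c;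
      M_range (int CARD('p)) a b c \<beta> \<gamma>\<^sub>1 \<gamma>\<^sub>2; M_range (int CARD('p)) a' b' c' \<beta>' \<gamma>\<^sub>1' \<gamma>\<^sub>2'\<rbrakk> \<Longrightarrow>
      \<beta>' = \<beta> \<and> \<gamma>\<^sub>1' = \<gamma>\<^sub>1 \<and> \<gamma>\<^sub>2' = \<gamma>\<^sub>2"
proof -
  let ?p = "int CARD('p)"
  let ?M = "M_matrix a b c \<beta> \<gamma>\<^sub>1 \<gamma>\<^sub>2" and ?M' = "M_matrix a' b' c' \<beta>' \<gamma>\<^sub>1' \<gamma>\<^sub>2'"
  have KZ: "K $ i $ j \<in> padic_integers" for i j
    using K by (simp add: integral_matrix_def)
  have e: "?M' $ i $ j = ?M $ i $ 1 * K $ 1 $ j + ?M $ i $ 2 * K $ 2 $ j + ?M $ i $ 3 * K $ 3 $ j" for i j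
    by (simp add: eq matrix_matrix_mult_def sum_3)
  have K31: "K $ 3 $ 1 = 0" using e[of 3 1] by simp
  have K32: "K $ 3 $ 2 = 0" using e[of 3 2] by simp
  have K21: "K $ 2 $ 1 = 0" using e[of 2 1] by (simp add: K31)
  have K33: "PP ^ c' = PP ^ c * K $ 3 $ 3" using e[of 3 3] by simp
  have K22: "PP ^ b' = PP ^ b * K $ 2 $ 2" using e[of 2 2] by (simp add: K32)
  have K11: "PP ^ a' = PP ^ a * K $ 1 $ 1" using e[of 1 1] by (simp add: K31 K21)
  have le: "n \<le> n'" if "PP ^ n' = PP ^ n * K $ i $ i" for n n' i
  proof -
    have "of_int (?p ^ n') / PP ^ n \<in> (padic_integers :: 'p padic set)"
      using that KZ[of i i] by simp
    then have "?p ^ n dvd ?p ^ n'" unfolding of_int_div_PP_power_iff .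
    then have "CARD('p) ^ n dvd CARD('p) ^ n'"
      by (simp only: of_nat_power[symmetric] int_dvd_int_iff)
    then show ?thesis
      using card_gt_1[where 'p='p] by (simp add: power_dvd_imp_le)
  qed
  show "a \<le> a'" "b \<le> b'" "c \<le> c'"
    using le[OF K11] le[OF K22] le[OF K33] by auto
  assume same: "a' = a" "b' = b" "c' = c"
    and M: "M_range ?p a b c \<beta> \<gamma>\<^sub>1 \<gamma>\<^sub>2" and M': "M_range ?p a' b' c' \<beta>' \<gamma>\<^sub>1' \<gamma>\<^sub>2'"
  have residue: "x = y"
    if "of_int x = PP ^ n * K $ i $ j + of_int y" "x \<in> {0..?p ^ n - 1}" "y \<in> {0..?p ^ n - 1}"
    for x y n i j
  proof -
    have "of_int (x - y) / PP ^ n \<in> (padic_integers :: 'p padic set)"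
      using that(1) KZ[of i j] by simp
    then have "?p ^ n dvd x - y" unfolding of_int_div_PP_power_iff .
    then have "x mod ?p ^ n = y mod ?p ^ n" by (simp add: mod_eq_dvd_iff)
    then show ?thesis using that(2,3) by simp
  qed
  have K1: "K $ 2 $ 2 = 1" "K $ 3 $ 3 = 1"
    using K22 K33 same by simp_all
  have \<beta>: "\<beta>' = \<beta>"
    using residue[of \<beta>' a 1 2 \<beta>] e[of 1 2] M M' by (simp add: K1 K32 same M_range_def)
  have \<gamma>\<^sub>2: "\<gamma>\<^sub>2' = \<gamma>\<^sub>2"
    using residue[of \<gamma>\<^sub>2' b 2 3 \<gamma>\<^sub>2] e[of 2 3] M M' by (simp add: K1 same M_range_def)
  \<comment> \<open>The corner entry comes last: its equation contains
    \<open>\<beta> * K $ 2 $ 3\<close>, which vanishes once the entries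
    \<open>\<gamma>\<^sub>2\<close> agree.\<close>
  then have K23: "K $ 2 $ 3 = 0"
    using e[of 2 3] by (simp add: K1)
  have "\<gamma>\<^sub>1' = \<gamma>\<^sub>1"
    using residue[of \<gamma>\<^sub>1' a 1 3 \<gamma>\<^sub>1] e[of 1 3] M M' by (simp add: K1 K23 same M_range_def)
  with \<beta> \<gamma>\<^sub>2 show "\<beta>' = \<beta> \<and> \<gamma>\<^sub>1' = \<gamma>\<^sub>1 \<and> \<gamma>\<^sub>2' = \<gamma>\<^sub>2" by simp
qed

text \<open>The entrywise embedding respects products, so the inverse of \<open>k\<close> over the
  p-adic integers supplies the reverse factor.\<close>

lemma right_equivalent_integral:
  fixes m m' :: "'p::prime_card padic ^ 3 ^ 3"
  assumes "right_equivalent m m'"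
  obtains K K' where "integral_matrix K" "integral_matrix K'" "m' = m ** K" "m = m' ** K'"
proof -
  define F :: "'p padic_int ^ 3 ^ 3 \<Rightarrow> 'p padic ^ 3 ^ 3"
    where "F A = (\<chi> i j. of_padic_int (A $ i $ j))" for A
  have F_mult: "F (A ** B) = F A ** F B" for A B
    by (simp add: F_def matrix_matrix_mult_def vec_eq_iff of_padic_int_sum of_padic_int_mult)
  have F_1: "F (mat 1) = mat 1"
    by (simp add: F_def mat_def vec_eq_iff)
  have F_int: "integral_matrix (F A)" for A
    by (simp add: F_def integral_matrix_def)
  obtain k k' where "m' = m ** F k" "k ** k' = mat 1"
    using assms by (auto simp: right_equivalent_def invertible_def F_def)
  then have "m = m' ** F k'"
    by (simp add: matrix_mul_assoc[symmetric] F_mult[symmetric] F_1)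
  then show ?thesis
    using that F_int \<open>m' = m ** F k\<close> by blast
qed

lemma right_equivalent_refl: "right_equivalent m m"
proof -
  have "(\<chi> i j. of_padic_int ((mat 1 :: 'a padic_int ^ 3 ^ 3) $ i $ j)) = (mat 1 :: 'a padic ^ 3 ^ 3)"
    by (simp add: mat_def vec_eq_iff)
  then show ?thesis
    unfolding right_equivalent_def
    by (intro exI[of _ "mat 1"]) (auto simp: invertible_def intro!: exI[of _ "mat 1"])
qed

text \<open>Integral factors in both directions force equal exponents, after which one direction
  identifies the entries.\<close>

lemma M_matrix_right_equivalent_unique:
  assumes "M_range (int CARD('p)) a b c \<beta> \<gamma>\<^sub>1 \<gamma>\<^sub>2" "M_range (int CARD('p)) a' b' c' \<beta>' \<gamma>\<^sub>1' \<gamma>\<^sub>2'"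
    and "right_equivalent (M_matrix a b c \<beta> \<gamma>\<^sub>1 \<gamma>\<^sub>2 :: 'p::prime_card padic ^ 3 ^ 3)
      (M_matrix a' b' c' \<beta>' \<gamma>\<^sub>1' \<gamma>\<^sub>2')"
  shows "a' = a \<and> b' = b \<and> c' = c \<and> \<beta>' = \<beta> \<and> \<gamma>\<^sub>1' = \<gamma>\<^sub>1 \<and> \<gamma>\<^sub>2' = \<gamma>\<^sub>2"
proof -
  obtain K K' :: "'p padic ^ 3 ^ 3" where K: "integral_matrix K"
      "M_matrix a' b' c' \<beta>' \<gamma>\<^sub>1' \<gamma>\<^sub>2' = M_matrix a b c \<beta> \<gamma>\<^sub>1 \<gamma>\<^sub>2 ** K"
    and K': "integral_matrix K'"
      "M_matrix a b c \<beta> \<gamma>\<^sub>1 \<gamma>\<^sub>2 = M_matrix a' b' c' \<beta>' \<gamma>\<^sub>1' \<gamma>\<^sub>2' ** K'"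
    using right_equivalent_integral[OF assms(3)] by metis
  have "a' = a" "b' = b" "c' = c"
    using M_matrix_right_multiple_le[OF K] M_matrix_right_multiple_le[OF K'] by auto
  with M_matrix_right_multiple_unique[OF K] assms(1,2) show ?thesis by blast
qed

text \<open>By uniqueness the existential quantifiers in \<open>admissible\<close> can only be
  instantiated by the given parameters.\<close>

lemma admissible_M_matrix_iff:
  fixes \<psi> :: "'p::prime_card padic \<Rightarrow> complex"
  assumes "unramified_character \<psi>" "M_range (int CARD('p)) a b c \<beta> \<gamma>\<^sub>1 \<gamma>\<^sub>2"
  shows "admissible D \<psi> (M_matrix a b c \<beta> \<gamma>\<^sub>1 \<gamma>\<^sub>2) \<longleftrightarrow>
    trace_integral D (U_group a b c \<beta> \<gamma>\<^sub>1 \<gamma>\<^sub>2 :: ('p padic ^ 2 ^ 2) set)"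
proof -
  have "admissible D \<psi> (M_matrix a b c \<beta> \<gamma>\<^sub>1 \<gamma>\<^sub>2) \<longleftrightarrow>
      U_group a b c \<beta> \<gamma>\<^sub>1 \<gamma>\<^sub>2 \<subseteq> {u. chi D \<psi> u = 1}"
    unfolding admissible_def
    using assms(2) M_matrix_right_equivalent_unique[OF assms(2)] right_equivalent_refl by metis
  then show ?thesis
    using U_group_subset_ker_chi_iff[OF assms(1)] by blast
qed


section \<open>Haar measure and lattices with two generators\<close>

lemma measure_disjoint_translates:
  fixes \<mu> :: "('p::prime_card padic ^ 2 ^ 2) measure"
  assumes \<mu>: "normalized_haar \<mu>" and "finite I" "\<And>i. i \<in> I \<Longrightarrow> f i \<in> symmetric_matrices"
    and "disjoint_family_on (\<lambda>i. (+) (f i) ` integral_symmetric) I"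
  shows "measure \<mu> (\<Union>i\<in>I. (+) (f i) ` integral_symmetric) = real (card I)"
proof -
  have 1: "emeasure \<mu> integral_symmetric = 1"
    using \<mu> by (simp add: normalized_haar_def integral_symmetric_def)
  \<comment> \<open>\<open>emeasure\<close> vanishes on non-measurable sets, so nonzero values give measurability.\<close>
  then have "integral_symmetric \<in> sets \<mu>"
    using emeasure_notin_sets by fastforce
  with \<mu> assms(3) 1 have translate: "emeasure \<mu> ((+) (f i) ` integral_symmetric) = 1" if "i \<in> I" for i
    using that by (simp add: normalized_haar_def)
  then have "(\<lambda>i. (+) (f i) ` integral_symmetric) ` I \<subseteq> sets \<mu>"
    using emeasure_notin_sets by fastforce
  from sum_emeasure[OF this assms(4,2)]
  have "emeasure \<mu> (\<Union>i\<in>I. (+) (f i) ` integral_symmetric) = of_nat (card I)"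
    using translate by simp
  then show ?thesis
    by (simp add: measure_def)
qed

text \<open>Conditions on \<open>(r, s, t)\<close> dual to the generators \<open>p\<^bsup>-k\<^esup>(1, -h, h\<^sup>2)\<close> and \<open>p\<^bsup>-n\<^esup>(1, -g, g\<^sup>2)\<close>: the
  form \<open>g r + s\<close> kills the second, \<open>h r + s\<close> the first, and \<open>g h r + (g + h) s + t\<close> both.  For
  \<open>p \<nmid> g - h\<close> the bound on \<open>r\<close> would follow from the others, but only with inverses of \<open>p\<close>-adic
  units; having it as a condition lets integers modulo powers of \<open>p\<close> replace them.\<close>

definition padic_lattice ::
  "nat \<Rightarrow> nat \<Rightarrow> int \<Rightarrow> int \<Rightarrow> 'p::prime_card padic \<Rightarrow> 'p padic \<Rightarrow> 'p padic \<Rightarrow> bool" where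
  "padic_lattice k n g h r s t \<longleftrightarrow>
    PP ^ (k + n) * r \<in> padic_integers \<and>
    PP ^ k * (of_int g * r + s) \<in> padic_integers \<and>
    PP ^ n * (of_int h * r + s) \<in> padic_integers \<and>
    of_int (g * h) * r + of_int (g + h) * s + t \<in> padic_integers"

text \<open>At each generator two of the forms dual to the generators vanish, and the third is
  \<open>g - h\<close> or \<open>h - g\<close> over the power of \<open>p\<close>.\<close>

lemma padic_lattice_generators:
  "padic_lattice k n g h (1 / PP ^ k) (- of_int h / PP ^ k) (of_int h ^ 2 / PP ^ k :: 'p::prime_card padic)"
  "padic_lattice k n g h (1 / PP ^ n) (- of_int g / PP ^ n) (of_int g ^ 2 / PP ^ n :: 'p::prime_card padic)"
proof -
  have *: "of_int g / PP ^ k - of_int h / PP ^ k = (of_int (g - h) / PP ^ k :: 'p padic)"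
    "of_int h / PP ^ n - of_int g / PP ^ n = (of_int (h - g) / PP ^ n :: 'p padic)"
    "PP ^ k / PP ^ k = (1 :: 'p padic)" "PP ^ n / PP ^ n = (1 :: 'p padic)"
    by (simp_all add: diff_divide_distrib)
  have P: "PP ^ l \<in> (padic_integers :: 'p padic set)" for l
    by (simp add: padic_integers_power)
  have d: "(of_int x - of_int y :: 'p padic) \<in> padic_integers" for x y
    by (intro padic_integers_diff) simp_all
  show "padic_lattice k n g h (1 / PP ^ k) (- of_int h / PP ^ k) (of_int h ^ 2 / PP ^ k :: 'p padic)"
    unfolding padic_lattice_def
    by (simp add: * power_add P d diff_divide_distrib[symmetric] del: of_int_diff)
      (simp add: field_simps power2_eq_square)
  show "padic_lattice k n g h (1 / PP ^ n) (- of_int g / PP ^ n) (of_int g ^ 2 / PP ^ n :: 'p padic)"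
    unfolding padic_lattice_def
    by (simp add: * power_add P d diff_divide_distrib[symmetric] del: of_int_diff)
      (simp add: field_simps power2_eq_square)
qed

text \<open>Evaluation at the two generators gives the congruences. Conversely, these make
  \<open>(g - h) (t - D r)\<close> integral, and \<open>g - h\<close> is cancelled.\<close>

lemma padic_lattice_trace_integral_iff:
  assumes "\<not> int CARD('p::prime_card) dvd g - h"
  shows "(\<forall>r s t :: 'p padic. padic_lattice k n g h r s t \<longrightarrow> t - of_int D * r \<in> padic_integers) \<longleftrightarrow>
    [h\<^sup>2 = D] (mod int CARD('p) ^ k) \<and> [g\<^sup>2 = D] (mod int CARD('p) ^ n)"
proof
  assume *: "\<forall>r s t :: 'p padic. padic_lattice k n g h r s t \<longrightarrow> t - of_int D * r \<in> padic_integers"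
  have "of_int (h\<^sup>2 - D) / PP ^ k \<in> (padic_integers :: 'p padic set)"
    "of_int (g\<^sup>2 - D) / PP ^ n \<in> (padic_integers :: 'p padic set)"
    using *[rule_format, OF padic_lattice_generators(1)] *[rule_format, OF padic_lattice_generators(2)]
    by (simp_all add: diff_divide_distrib)
  then show "[h\<^sup>2 = D] (mod int CARD('p) ^ k) \<and> [g\<^sup>2 = D] (mod int CARD('p) ^ n)"
    unfolding of_int_div_PP_power_iff by (simp add: cong_iff_dvd_diff)
next
  assume *: "[h\<^sup>2 = D] (mod int CARD('p) ^ k) \<and> [g\<^sup>2 = D] (mod int CARD('p) ^ n)"
  show "\<forall>r s t :: 'p padic. padic_lattice k n g h r s t \<longrightarrow> t - of_int D * r \<in> padic_integers"
  proof (intro allI impI)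
    fix r s t :: "'p padic" assume L: "padic_lattice k n g h r s t"
    obtain x where x: "h\<^sup>2 - D = int CARD('p) ^ k * x"
      using * by (auto simp: cong_iff_dvd_diff)
    obtain y where y: "g\<^sup>2 - D = int CARD('p) ^ n * y"
      using * by (auto simp: cong_iff_dvd_diff)
    let ?\<rho> = "of_int g * r + s" and ?\<zeta> = "of_int h * r + s"
      and ?\<eta> = "of_int (g * h) * r + of_int (g + h) * s + t"
    have Z: "PP ^ (k + n) * r \<in> padic_integers" "PP ^ k * ?\<rho> \<in> padic_integers"
      "PP ^ n * ?\<zeta> \<in> padic_integers" "?\<eta> \<in> padic_integers"
      using L by (simp_all add: padic_lattice_def)
    \<comment> \<open>Expansion in the three dual forms. The coefficients of the first two are the
      quadratic defects, divisible by \<open>p ^ k\<close> and \<open>p ^ n\<close>.\<close>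
    have "of_int (g - h) * (t - of_int D * r) =
        of_int (h\<^sup>2 - D) * ?\<rho> - of_int (g\<^sup>2 - D) * ?\<zeta> + of_int (g - h) * ?\<eta>"
      by (simp add: algebra_simps power2_eq_square)
    also have "\<dots> = of_int x * (PP ^ k * ?\<rho>) - of_int y * (PP ^ n * ?\<zeta>) + of_int (g - h) * ?\<eta>"
      unfolding x y by (simp add: mult_ac)
    also have "\<dots> \<in> padic_integers"
      by (intro padic_integers_add padic_integers_diff padic_integers_of_int_mult Z)
    finally have 1: "of_int (g - h) * (t - of_int D * r) \<in> padic_integers" .
    \<comment> \<open>Cancelling \<open>g - h\<close> also takes a power of \<open>p\<close> that
      clears the denominators; here the bound on \<open>r\<close> enters.\<close>
    have "PP ^ (k + n) * (t - of_int D * r) =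
        of_int (int CARD('p) ^ (k + n)) * ?\<eta> - of_int ((g + h) * int CARD('p) ^ n) * (PP ^ k * ?\<rho>)
          + of_int (g * g - D) * (PP ^ (k + n) * r)"
      by (simp add: algebra_simps power_add)
    also have "\<dots> \<in> padic_integers"
      by (intro padic_integers_add padic_integers_diff padic_integers_of_int_mult Z)
    finally show "t - of_int D * r \<in> padic_integers"
      using 1 assms by (rule padic_integers_cancel_coprime)
  qed
qed

text \<open>The two generators span the lattice modulo integral matrices, and the multipliers are unique
  modulo \<open>p ^ k\<close> and \<open>p ^ n\<close>, so the integral matrices have index \<open>p ^ (k + n)\<close>.\<close>

definition lattice_representative :: "nat \<Rightarrow> nat \<Rightarrow> int \<Rightarrow> int \<Rightarrow> int \<times> int \<Rightarrow> 'p::prime_card padic ^ 2 ^ 2" where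
  "lattice_representative k n g h = (\<lambda>(i, j). sym2
    (of_int i / PP ^ k + of_int j / PP ^ n)
    (- (of_int (i * h) / PP ^ k) - of_int (j * g) / PP ^ n)
    (of_int (i * h\<^sup>2) / PP ^ k + of_int (j * g\<^sup>2) / PP ^ n))"

lemma sym2_in_translate_iff:
  "sym2 r s t \<in> (+) (sym2 r' s' t') ` integral_symmetric \<longleftrightarrow>
    r - r' \<in> padic_integers \<and> s - s' \<in> padic_integers \<and> t - t' \<in> (padic_integers :: 'p::prime_card padic set)"
proof
  assume "sym2 r s t \<in> (+) (sym2 r' s' t') ` integral_symmetric"
  then obtain u where u: "sym2 r s t = sym2 r' s' t' + u" "u \<in> integral_symmetric" by blast
  then obtain x y z where "u = sym2 x y z"
    by (metis (no_types, lifting) integral_symmetric_def mem_Collect_eq symmetric_matricesE)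
  then show "r - r' \<in> padic_integers \<and> s - s' \<in> padic_integers \<and> t - t' \<in> padic_integers"
    using u by (simp add: sym2_add sym2_in_integral_symmetric_iff)
next
  assume *: "r - r' \<in> padic_integers \<and> s - s' \<in> padic_integers \<and> t - t' \<in> padic_integers"
  have "sym2 r s t = sym2 r' s' t' + sym2 (r - r') (s - s') (t - t')"
    by (simp add: sym2_add)
  then show "sym2 r s t \<in> (+) (sym2 r' s' t') ` integral_symmetric"
    using * by (metis sym2_in_integral_symmetric_iff image_eqI)
qed

lemma translate_integral_symmetric:
  fixes u :: "'p::prime_card padic ^ 2 ^ 2"
  assumes "u \<in> (+) v ` integral_symmetric" "v \<in> symmetric_matrices"
  shows "u \<in> symmetric_matrices"
proof -
  obtain w where w: "u = v + w" "w \<in> symmetric_matrices"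
    using assms(1) by (auto simp: integral_symmetric_def)
  obtain r s t where "v = sym2 r s t" using assms(2) by (rule symmetric_matricesE)
  moreover obtain r s t where "w = sym2 r s t" using w(2) by (rule symmetric_matricesE)
  ultimately show ?thesis by (simp add: w(1) sym2_add)
qed

lemma lattice_representative_symmetric: "lattice_representative k n g h x \<in> symmetric_matrices"
  by (cases x) (simp add: lattice_representative_def)

text \<open>On the representative of \<open>(i, j)\<close> the form \<open>g r + s\<close> equals
  \<open>i (g - h) / p ^ k\<close> and \<open>h r + s\<close> equals
  \<open>- j (g - h) / p ^ n\<close>. So the multipliers of a lattice element are read off from
  these forms by inverting \<open>g - h\<close> modulo powers of \<open>p\<close>.\<close>

lemma padic_lattice_decomposition:
  fixes r s t :: "'p::prime_card padic"
  assumes gh: "\<not> int CARD('p) dvd g - h"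
  shows "padic_lattice k n g h r s t \<longleftrightarrow>
    (\<exists>x \<in> {0..<int CARD('p) ^ k} \<times> {0..<int CARD('p) ^ n}.
      sym2 r s t \<in> (+) (lattice_representative k n g h x) ` integral_symmetric)"
proof -
  let ?p = "int CARD('p)" and ?Z = "padic_integers :: 'p padic set"
  let ?\<rho> = "of_int g * r + s" and ?\<zeta> = "of_int h * r + s"
    and ?\<eta> = "of_int (g * h) * r + of_int (g + h) * s + t"
  \<comment> \<open>What remains of \<open>(r, s, t)\<close> after subtracting the representative of
    \<open>(i, j)\<close>.\<close>
  define r' s' t' where "r' i j = r - (of_int i / PP ^ k + of_int j / PP ^ n)"
    and "s' i j = s - (- (of_int (i * h) / PP ^ k) - of_int (j * g) / PP ^ n)"
    and "t' i j = t - (of_int (i * h\<^sup>2) / PP ^ k + of_int (j * g\<^sup>2) / PP ^ n)" for i j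
  have mem: "sym2 r s t \<in> (+) (lattice_representative k n g h (i, j)) ` integral_symmetric \<longleftrightarrow>
      r' i j \<in> ?Z \<and> s' i j \<in> ?Z \<and> t' i j \<in> ?Z" for i j
    by (simp only: lattice_representative_def split_conv sym2_in_translate_iff r'_def s'_def t'_def)
  have \<rho>: "?\<rho> = of_int g * r' i j + s' i j + of_int (i * (g - h)) / PP ^ k" for i j
    by (simp add: r'_def s'_def algebra_simps diff_divide_distrib)
  have \<zeta>: "?\<zeta> = of_int h * r' i j + s' i j - of_int (j * (g - h)) / PP ^ n" for i j
    by (simp add: r'_def s'_def algebra_simps diff_divide_distrib)
  have \<eta>: "?\<eta> = of_int (g * h) * r' i j + of_int (g + h) * s' i j + t' i j" for i j
    by (simp add: r'_def s'_def t'_def algebra_simps power2_eq_square add_divide_distrib)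
  have r: "PP ^ (k + n) * r = PP ^ (k + n) * r' i j + of_int (i * ?p ^ n + j * ?p ^ k)" for i j
    by (simp add: r'_def power_add algebra_simps)
  show ?thesis
  proof
    assume L: "padic_lattice k n g h r s t"
    have "prime ?p" using prime_card[where 'a='p] by simp
    then have "coprime (?p ^ (k + n)) (g - h)"
      using gh by (simp add: prime_imp_coprime)
    \<comment> \<open>\<open>c\<close> inverts \<open>g - h\<close> modulo \<open>p ^ k\<close> and
      \<open>p ^ n\<close>; \<open>i\<close> and \<open>j\<close> below are the residues of
      \<open>c X\<close> and \<open>- c Y\<close>.\<close>
    then obtain e c where ec: "e * ?p ^ (k + n) + c * (g - h) = 1"
      by (metis bezout_int coprime_iff_gcd_eq_1)
    then have "of_int (e * ?p ^ (k + n) + c * (g - h)) = (1 :: 'p padic)"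
      by (simp only: of_int_1)
    then have ec': "of_int e * PP ^ (k + n) + of_int c * of_int (g - h) = (1 :: 'p padic)"
      by (simp del: of_int_diff)
    define X where "X = PP ^ k * ?\<rho>"
    define Y where "Y = PP ^ n * ?\<zeta>"
    have XY: "X \<in> ?Z" "Y \<in> ?Z"
      using L by (simp_all add: padic_lattice_def X_def Y_def)
    obtain i where i: "0 \<le> i" "i < ?p ^ k" "(of_int c * X - of_int i) / PP ^ k \<in> ?Z"
      using padic_integers_approx[OF padic_integers_of_int_mult[OF XY(1)]] by metis
    obtain j where j: "0 \<le> j" "j < ?p ^ n" "(of_int (- c) * Y - of_int j) / PP ^ n \<in> ?Z"
      using padic_integers_approx[OF padic_integers_of_int_mult[OF XY(2)]] by metis
    have "of_int g * r' i j + s' i j = ?\<rho> - of_int (i * (g - h)) / PP ^ k"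
      using \<rho>[of i j] by simp
    \<comment> \<open>The explicit factor 1 is there to be replaced by the Bezout identity, which
      splits off \<open>c X - i\<close>.\<close>
    also have "\<dots> = (1 * X - of_int i * of_int (g - h)) / PP ^ k"
      by (simp add: X_def diff_divide_distrib)
    also have "\<dots> = of_int (g - h) * ((of_int c * X - of_int i) / PP ^ k) + of_int (e * ?p ^ n) * X"
      unfolding ec'[symmetric] by (simp add: field_simps power_add)
    also have "\<dots> \<in> ?Z"
      by (intro padic_integers_add padic_integers_of_int_mult i XY)
    finally have \<rho>': "of_int g * r' i j + s' i j \<in> ?Z" .
    have "of_int h * r' i j + s' i j = ?\<zeta> + of_int (j * (g - h)) / PP ^ n"
      using \<zeta>[of i j] by simp
    also have "\<dots> = (1 * Y + of_int j * of_int (g - h)) / PP ^ n"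
      by (simp add: Y_def add_divide_distrib)
    also have "\<dots> = of_int (h - g) * ((of_int (- c) * Y - of_int j) / PP ^ n) + of_int (e * ?p ^ k) * Y"
      unfolding ec'[symmetric] by (simp add: field_simps power_add)
    also have "\<dots> \<in> ?Z"
      by (intro padic_integers_add padic_integers_of_int_mult j XY)
    finally have \<zeta>': "of_int h * r' i j + s' i j \<in> ?Z" .
    \<comment> \<open>The difference of the two forms isolates the first entry; cancelling
      \<open>g - h\<close> then makes it integral.\<close>
    have "of_int (g - h) * r' i j = (of_int g * r' i j + s' i j) - (of_int h * r' i j + s' i j)"
      by (simp add: algebra_simps)
    then have 1: "of_int (g - h) * r' i j \<in> ?Z"
      using padic_integers_diff[OF \<rho>' \<zeta>'] by simp
    have "PP ^ (k + n) * r' i j = PP ^ (k + n) * r - of_int (i * ?p ^ n + j * ?p ^ k)"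
      using r[of i j] by simp
    also have "\<dots> \<in> ?Z"
      using L unfolding padic_lattice_def by (blast intro: padic_integers_diff padic_integers_of_int)
    finally have r'Z: "r' i j \<in> ?Z"
      using 1 gh by (rule padic_integers_cancel_coprime)
    have s'Z: "s' i j \<in> ?Z"
      using padic_integers_diff[OF \<rho>' padic_integers_of_int_mult[OF r'Z, of g]] by simp
    have "?\<eta> \<in> ?Z" using L by (simp add: padic_lattice_def)
    then have "?\<eta> - (of_int (g * h) * r' i j + of_int (g + h) * s' i j) \<in> ?Z"
      by (rule padic_integers_diff) (intro padic_integers_add padic_integers_of_int_mult r'Z s'Z)
    then have "t' i j \<in> ?Z" unfolding \<eta>[of i j] by simp
    then show "\<exists>x \<in> {0..<?p ^ k} \<times> {0..<?p ^ n}.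
        sym2 r s t \<in> (+) (lattice_representative k n g h x) ` integral_symmetric"
      using i j r'Z s'Z mem by (intro bexI[of _ "(i, j)"]) auto
  next
    assume "\<exists>x \<in> {0..<?p ^ k} \<times> {0..<?p ^ n}.
        sym2 r s t \<in> (+) (lattice_representative k n g h x) ` integral_symmetric"
    then obtain i j where "r' i j \<in> ?Z \<and> s' i j \<in> ?Z \<and> t' i j \<in> ?Z"
      using mem by auto
    then have Z: "r' i j \<in> ?Z" "s' i j \<in> ?Z" "t' i j \<in> ?Z" by auto
    have 1: "PP ^ k * ?\<rho> = of_int (?p ^ k) * (of_int g * r' i j + s' i j) + of_int (i * (g - h))"
      unfolding \<rho>[of i j] by (simp add: distrib_left[of "PP ^ k"])
    have 2: "PP ^ n * ?\<zeta> = of_int (?p ^ n) * (of_int h * r' i j + s' i j) - of_int (j * (g - h))"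
      unfolding \<zeta>[of i j] by (simp add: right_diff_distrib[of "PP ^ n"])
    have 3: "PP ^ (k + n) * r = of_int (?p ^ (k + n)) * r' i j + of_int (i * ?p ^ n + j * ?p ^ k)"
      using r[of i j] by simp
    have 4: "?\<eta> \<in> ?Z"
      by (subst \<eta>[of i j]) (intro padic_integers_add padic_integers_of_int_mult Z)
    show "padic_lattice k n g h r s t"
      unfolding padic_lattice_def 1 2 3
      by (intro conjI 4 padic_integers_add padic_integers_diff padic_integers_of_int
          padic_integers_of_int_mult Z)
  qed
qed

text \<open>On a common element the two forms determine \<open>i (g - h)\<close> modulo
  \<open>p ^ k\<close> and \<open>j (g - h)\<close> modulo \<open>p ^ n\<close>; then
  \<open>g - h\<close> cancels and the index ranges give equality.\<close>

lemma lattice_representative_disjoint: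
  assumes gh: "\<not> int CARD('p::prime_card) dvd g - h"
  shows "disjoint_family_on (\<lambda>x. (+) (lattice_representative k n g h x :: 'p padic ^ 2 ^ 2) ` integral_symmetric)
    ({0..<int CARD('p) ^ k} \<times> {0..<int CARD('p) ^ n})"
unfolding disjoint_family_on_def
proof (intro ballI impI)
  let ?p = "int CARD('p)" and ?Z = "padic_integers :: 'p padic set"
  let ?T = "\<lambda>x. (+) (lattice_representative k n g h x :: 'p padic ^ 2 ^ 2) ` integral_symmetric"
  fix x y assume x: "x \<in> {0..<?p ^ k} \<times> {0..<?p ^ n}" and y: "y \<in> {0..<?p ^ k} \<times> {0..<?p ^ n}"
    and "x \<noteq> y"
  have "x = y" if "u \<in> ?T x" "u \<in> ?T y" for u
  proof -
    obtain i j i' j' where xy: "x = (i, j)" "y = (i', j')" by (metis surj_pair)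
    have "u \<in> symmetric_matrices"
      using that(1) lattice_representative_symmetric translate_integral_symmetric by blast
    then obtain r s t where u: "u = sym2 r s t" by (rule symmetric_matricesE)
    let ?r = "\<lambda>i j. r - (of_int i / PP ^ k + of_int j / PP ^ n)"
    let ?s = "\<lambda>i j. s - (- (of_int (i * h) / PP ^ k) - of_int (j * g) / PP ^ n)"
    have Z: "?r i j \<in> ?Z" "?s i j \<in> ?Z" "?r i' j' \<in> ?Z" "?s i' j' \<in> ?Z"
      using that by (simp_all only: u xy lattice_representative_def split_conv sym2_in_translate_iff)
    have cancel: "a = b" if "of_int ((a - b) * (g - h)) / PP ^ l \<in> ?Z" "a \<in> {0..<?p ^ l}" "b \<in> {0..<?p ^ l}"
      for a b l
    proof -
      have "?p ^ l dvd (a - b) * (g - h)" using that(1) unfolding of_int_div_PP_power_iff .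
      moreover have "prime ?p" using prime_card[where 'a='p] by simp
      ultimately have "?p ^ l dvd a - b"
        using gh by (simp add: coprime_dvd_mult_left_iff prime_imp_coprime)
      then have "a mod ?p ^ l = b mod ?p ^ l" by (simp add: mod_eq_dvd_iff)
      then show ?thesis using that(2,3) by simp
    qed
    have "of_int ((i - i') * (g - h)) / PP ^ k =
        (of_int g * ?r i' j' + ?s i' j') - (of_int g * ?r i j + ?s i j)"
      by (simp add: algebra_simps diff_divide_distrib add_divide_distrib)
    also have "\<dots> \<in> ?Z"
      by (intro padic_integers_diff padic_integers_add padic_integers_of_int_mult Z)
    finally have "i = i'"
      using x y by (intro cancel[of i i' k]) (auto simp: xy)
    have "of_int ((j - j') * (g - h)) / PP ^ n =
        (of_int h * ?r i j + ?s i j) - (of_int h * ?r i' j' + ?s i' j')"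
      by (simp add: algebra_simps diff_divide_distrib add_divide_distrib)
    also have "\<dots> \<in> ?Z"
      by (intro padic_integers_diff padic_integers_add padic_integers_of_int_mult Z)
    finally have "j = j'"
      using x y by (intro cancel[of j j' n]) (auto simp: xy)
    with \<open>i = i'\<close> show ?thesis by (simp add: xy)
  qed
  with \<open>x \<noteq> y\<close> show "?T x \<inter> ?T y = {}" by blast
qed

lemma measure_padic_lattice:
  fixes \<mu> :: "('p::prime_card padic ^ 2 ^ 2) measure"
  assumes \<mu>: "normalized_haar \<mu>" and gh: "\<not> int CARD('p) dvd g - h"
    and U: "U \<subseteq> symmetric_matrices" "\<And>r s t. sym2 r s t \<in> U \<longleftrightarrow> padic_lattice k n g h r s t"
  shows "measure \<mu> U = real CARD('p) ^ (k + n)"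
proof -
  let ?I = "{0..<int CARD('p) ^ k} \<times> {0..<int CARD('p) ^ n}"
  let ?V = "\<Union>x\<in>?I. (+) (lattice_representative k n g h x) ` (integral_symmetric :: ('p padic ^ 2 ^ 2) set)"
  have rep: "lattice_representative k n g h x \<in> (symmetric_matrices :: ('p padic ^ 2 ^ 2) set)" for x
    by (rule lattice_representative_symmetric)
  then have V: "?V \<subseteq> symmetric_matrices"
    using translate_integral_symmetric by blast
  have "sym2 r s t \<in> U \<longleftrightarrow> sym2 r s t \<in> ?V" for r s t
    unfolding U(2) padic_lattice_decomposition[OF gh] by blast
  then have "u \<in> U \<longleftrightarrow> u \<in> ?V" if "u \<in> symmetric_matrices" for u
    using that by (elim symmetric_matricesE) simp
  with U(1) V have "U = ?V" by blast
  then have "measure \<mu> U = real (card ?I)"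
    using measure_disjoint_translates[OF \<mu> _ rep lattice_representative_disjoint[OF gh]] by simp
  then show ?thesis by (simp add: power_add nat_power_eq)
qed


section \<open>\<open>U_group\<close> as a lattice in each case\<close>

text \<open>Turns an integrality claim into a ring identity; the idea of each use lies in the
  integer coefficients supplied.\<close>

lemma padic_integers_lincomb:
  "\<lbrakk>x \<in> padic_integers; y \<in> padic_integers; z = of_int i * x + of_int j * y\<rbrakk> \<Longrightarrow> z \<in> padic_integers"
  by (simp add: padic_integers_add padic_integers_of_int_mult)

text \<open>For \<open>k = 0\<close> the parameter \<open>h\<close> only matters through \<open>p \<nmid> g - h\<close>; the choice is \<open>h = g + 1\<close>.\<close>

lemma padic_lattice_0_Suc_iff:
  "padic_lattice 0 n g (g + 1) r s t \<longleftrightarrow>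
    PP ^ n * r \<in> padic_integers \<and> of_int g * r + s \<in> padic_integers \<and>
    of_int g * s + t \<in> (padic_integers :: 'p::prime_card padic set)" (is "?L \<longleftrightarrow> ?R")
proof
  assume ?L
  then have L: "PP ^ n * r \<in> padic_integers" "of_int g * r + s \<in> padic_integers"
    "of_int (g * (g + 1)) * r + of_int (g + (g + 1)) * s + t \<in> padic_integers"
    by (simp_all add: padic_lattice_def)
  have "of_int g * s + t \<in> padic_integers"
    by (rule padic_integers_lincomb[OF L(3,2), of _ 1 "- (g + 1)"]) (simp add: algebra_simps)
  with L show ?R by simp
next
  assume ?R
  then have R: "PP ^ n * r \<in> padic_integers" "of_int g * r + s \<in> padic_integers"
    "of_int g * s + t \<in> padic_integers"
    by simp_all
  have "PP ^ n * (of_int (g + 1) * r + s) \<in> padic_integers"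
    by (rule padic_integers_lincomb[OF R(2,1), of _ "int CARD('p) ^ n" 1]) (simp add: algebra_simps)
  moreover have "of_int (g * (g + 1)) * r + of_int (g + (g + 1)) * s + t \<in> padic_integers"
    by (rule padic_integers_lincomb[OF R(2,3), of _ "g + 1" 1]) (simp add: algebra_simps)
  ultimately show ?L using R by (simp add: padic_lattice_def)
qed

text \<open>Gives the criterion and the measure at once, so that each case only has to supply
  \<open>k\<close>, \<open>n\<close>, \<open>g\<close>, \<open>h\<close>.\<close>

lemma U_group_lattice:
  fixes \<mu> :: "('p::prime_card padic ^ 2 ^ 2) measure"
  assumes "\<And>r s t :: 'p padic. sym2 r s t \<in> U_group a b c \<beta> \<gamma>\<^sub>1 \<gamma>\<^sub>2 \<longleftrightarrow> padic_lattice k n g h r s t"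
    and "\<not> int CARD('p) dvd g - h"
  shows U_group_lattice_trace_integral:
      "trace_integral D (U_group a b c \<beta> \<gamma>\<^sub>1 \<gamma>\<^sub>2 :: ('p padic ^ 2 ^ 2) set) \<longleftrightarrow>
        [h\<^sup>2 = D] (mod int CARD('p) ^ k) \<and> [g\<^sup>2 = D] (mod int CARD('p) ^ n)"
    and U_group_lattice_measure:
      "normalized_haar \<mu> \<Longrightarrow> measure \<mu> (U_group a b c \<beta> \<gamma>\<^sub>1 \<gamma>\<^sub>2) = real CARD('p) ^ (k + n)"
proof -
  show "trace_integral D (U_group a b c \<beta> \<gamma>\<^sub>1 \<gamma>\<^sub>2 :: ('p padic ^ 2 ^ 2) set) \<longleftrightarrow>
      [h\<^sup>2 = D] (mod int CARD('p) ^ k) \<and> [g\<^sup>2 = D] (mod int CARD('p) ^ n)"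
    unfolding trace_integral_def assms(1) padic_lattice_trace_integral_iff[OF assms(2)] ..
  have "U_group a b c \<beta> \<gamma>\<^sub>1 \<gamma>\<^sub>2 \<subseteq> (symmetric_matrices :: ('p padic ^ 2 ^ 2) set)"
    by (auto simp: U_group_def)
  then show "normalized_haar \<mu> \<Longrightarrow> measure \<mu> (U_group a b c \<beta> \<gamma>\<^sub>1 \<gamma>\<^sub>2) = real CARD('p) ^ (k + n)"
    using measure_padic_lattice assms by blast
qed

lemma prime_card_neq_1 [simp]: "CARD('p::prime_card) \<noteq> Suc 0"
  using prime_card[where 'a='p] by (metis One_nat_def not_prime_1)

lemma not_prime_card_dvd_unit: "\<not> int CARD('p::prime_card) dvd 1" "\<not> int CARD('p) dvd - 1"
  using card_gt_1[where 'p='p] by auto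

text \<open>For \<open>b = c = 0\<close> the conditions with \<open>\<gamma>\<^sub>1\<close> follow
  from integrality of \<open>u y\<close>.\<close>

lemma U_group_00_iff_lattice:
  "sym2 r s t \<in> U_group a 0 0 \<beta> \<gamma>\<^sub>1 0 \<longleftrightarrow> padic_lattice 0 a \<beta> (\<beta> + 1) r s (t :: 'p::prime_card padic)"
proof -
  have "PP ^ a * s \<in> padic_integers"
    if "PP ^ a * r \<in> padic_integers" "of_int \<beta> * r + s \<in> padic_integers"
    by (rule padic_integers_lincomb[OF that, of _ "- \<beta>" "int CARD('p) ^ a"]) (simp add: algebra_simps)
  moreover have "PP ^ a * (of_int \<gamma>\<^sub>1 * r) \<in> padic_integers" if "PP ^ a * r \<in> padic_integers"
    using padic_integers_of_int_mult[OF that, of \<gamma>\<^sub>1] by (simp add: mult_ac)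
  ultimately show ?thesis
    unfolding sym2_in_U_group_iff padic_lattice_0_Suc_iff
    by (auto intro: padic_integers_of_int_mult)
qed

text \<open>The condition with \<open>\<gamma>\<^sub>1\<close> says that
  \<open>\<gamma>\<^sub>1 r\<close> is integral. As \<open>\<gamma>\<^sub>1\<close> is a unit, only
  integral matrices remain.\<close>

lemma U_group_0_iff_lattice:
  assumes "\<not> int CARD('p::prime_card) dvd \<gamma>\<^sub>1"
  shows "sym2 r s t \<in> U_group a 0 a 0 \<gamma>\<^sub>1 0 \<longleftrightarrow> padic_lattice 0 0 0 1 r s (t :: 'p padic)"
proof -
  have "PP ^ a * x \<in> padic_integers" if "x \<in> padic_integers" for x :: "'p padic"
    using padic_integers_of_int_mult[OF that, of "int CARD('p) ^ a"] by simp
  moreover have "r \<in> padic_integers" if "PP ^ a * r \<in> padic_integers" "of_int \<gamma>\<^sub>1 * r \<in> padic_integers"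
    using that assms by (rule padic_integers_cancel_coprime)
  ultimately show ?thesis
    using padic_lattice_0_Suc_iff[of 0 0 r s t] unfolding sym2_in_U_group_iff
    by (auto intro: padic_integers_of_int_mult)
qed

text \<open>Since \<open>\<gamma>\<^sub>1\<close> is \<open>\<gamma>\<^sub>2 g\<close> modulo
  \<open>p ^ b\<close>, the conditions on the row vector concern \<open>\<gamma>\<^sub>2\<close>
  times \<open>g r + s\<close> and \<open>g s + t\<close>, and the unit
  \<open>\<gamma>\<^sub>2\<close> cancels.\<close>

lemma U_group_diag_iff_lattice:
  assumes \<gamma>: "\<not> int CARD('p::prime_card) dvd \<gamma>\<^sub>1" "\<not> int CARD('p) dvd \<gamma>\<^sub>2"
    and g: "[\<gamma>\<^sub>2 * g = \<gamma>\<^sub>1] (mod int CARD('p) ^ b)" and "b \<le> a"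
  shows "sym2 r s t \<in> U_group a b a 0 \<gamma>\<^sub>1 \<gamma>\<^sub>2 \<longleftrightarrow> padic_lattice 0 b g (g + 1) r s (t :: 'p padic)"
proof -
  let ?p = "int CARD('p)" and ?Z = "padic_integers :: 'p padic set"
  have min: "min b a = b" using \<open>b \<le> a\<close> by simp
  \<comment> \<open>\<open>e\<close> measures the error in this congruence; it enters only through
    \<open>p ^ b e r\<close> and \<open>p ^ b e s\<close>, which are integral.\<close>
  obtain e where "\<gamma>\<^sub>2 * g - \<gamma>\<^sub>1 = ?p ^ b * e"
    using g by (auto simp: cong_iff_dvd_diff)
  then have "\<gamma>\<^sub>1 = \<gamma>\<^sub>2 * g - ?p ^ b * e" by simp
  then have e: "of_int \<gamma>\<^sub>1 = of_int \<gamma>\<^sub>2 * of_int g - PP ^ b * (of_int e :: 'p padic)" by simp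
  obtain d where a: "a = b + d" using \<open>b \<le> a\<close> le_Suc_ex by blast
  have U_iff: "sym2 r s t \<in> U_group a b a 0 \<gamma>\<^sub>1 \<gamma>\<^sub>2 \<longleftrightarrow>
      PP ^ a * r \<in> ?Z \<and> PP ^ a * s \<in> ?Z \<and> PP ^ b * s \<in> ?Z \<and> PP ^ b * t \<in> ?Z \<and>
      of_int \<gamma>\<^sub>1 * r + of_int \<gamma>\<^sub>2 * s \<in> ?Z \<and> of_int \<gamma>\<^sub>1 * s + of_int \<gamma>\<^sub>2 * t \<in> ?Z"
  proof -
    have "(of_int \<gamma>\<^sub>1 * (of_int 0 * r + PP ^ b * s) + of_int \<gamma>\<^sub>2 * (of_int 0 * s + PP ^ b * t)) / PP ^ b
        = of_int \<gamma>\<^sub>1 * s + of_int \<gamma>\<^sub>2 * t"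
      by (simp add: field_simps)
    then show ?thesis unfolding sym2_in_U_group_iff min by simp
  qed
  show ?thesis
    unfolding U_iff padic_lattice_0_Suc_iff
  proof (intro iffI; elim conjE)
    assume U: "PP ^ a * r \<in> ?Z" "PP ^ a * s \<in> ?Z" "PP ^ b * s \<in> ?Z" "PP ^ b * t \<in> ?Z"
      "of_int \<gamma>\<^sub>1 * r + of_int \<gamma>\<^sub>2 * s \<in> ?Z" "of_int \<gamma>\<^sub>1 * s + of_int \<gamma>\<^sub>2 * t \<in> ?Z"
    \<comment> \<open>As \<open>a\<close> may exceed \<open>b\<close>, the sharper bound on
      \<open>r\<close> is drawn from \<open>\<gamma>\<^sub>1 r + \<gamma>\<^sub>2 s\<close> and the
      unit \<open>\<gamma>\<^sub>1\<close>.\<close>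
    have "PP ^ a * (PP ^ b * r) \<in> ?Z"
      using padic_integers_of_int_mult[OF U(1), of "?p ^ b"] by (simp add: mult_ac)
    moreover have "of_int \<gamma>\<^sub>1 * (PP ^ b * r) \<in> ?Z"
      by (rule padic_integers_lincomb[OF U(5,3), of _ "?p ^ b" "- \<gamma>\<^sub>2"]) (simp add: algebra_simps)
    ultimately have r: "PP ^ b * r \<in> ?Z"
      using \<gamma>(1) by (rule padic_integers_cancel_coprime)
    have "PP ^ b * (of_int g * r + s) \<in> ?Z"
      by (rule padic_integers_lincomb[OF r U(3), of _ g 1]) (simp add: algebra_simps)
    moreover have "of_int \<gamma>\<^sub>2 * (of_int g * r + s) \<in> ?Z"
      by (rule padic_integers_lincomb[OF U(5) r, of _ 1 e]) (simp add: e algebra_simps)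
    ultimately have s: "of_int g * r + s \<in> ?Z"
      using \<gamma>(2) by (rule padic_integers_cancel_coprime)
    have "PP ^ b * (of_int g * s + t) \<in> ?Z"
      by (rule padic_integers_lincomb[OF U(3,4), of _ g 1]) (simp add: algebra_simps)
    moreover have "of_int \<gamma>\<^sub>2 * (of_int g * s + t) \<in> ?Z"
      by (rule padic_integers_lincomb[OF U(6,3), of _ 1 e]) (simp add: e algebra_simps)
    ultimately have "of_int g * s + t \<in> ?Z"
      using \<gamma>(2) by (rule padic_integers_cancel_coprime)
    with r s show "PP ^ b * r \<in> ?Z \<and> of_int g * r + s \<in> ?Z \<and> of_int g * s + t \<in> ?Z" by simp
  next
    assume L: "PP ^ b * r \<in> ?Z" "of_int g * r + s \<in> ?Z" "of_int g * s + t \<in> ?Z"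
    have s: "PP ^ b * s \<in> ?Z"
      by (rule padic_integers_lincomb[OF L(2,1), of _ "?p ^ b" "- g"]) (simp add: algebra_simps)
    have t: "PP ^ b * t \<in> ?Z"
      by (rule padic_integers_lincomb[OF L(3) s, of _ "?p ^ b" "- g"]) (simp add: algebra_simps)
    have "PP ^ a * r \<in> ?Z" "PP ^ a * s \<in> ?Z"
      using padic_integers_of_int_mult[OF L(1), of "?p ^ d"] padic_integers_of_int_mult[OF s, of "?p ^ d"]
      by (simp_all add: a power_add mult_ac)
    moreover have "of_int \<gamma>\<^sub>1 * r + of_int \<gamma>\<^sub>2 * s \<in> ?Z"
      by (rule padic_integers_lincomb[OF L(2,1), of _ \<gamma>\<^sub>2 "- e"]) (simp add: e algebra_simps)
    moreover have "of_int \<gamma>\<^sub>1 * s + of_int \<gamma>\<^sub>2 * t \<in> ?Z"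
      by (rule padic_integers_lincomb[OF L(3) s, of _ \<gamma>\<^sub>2 "- e"]) (simp add: e algebra_simps)
    ultimately show "PP ^ a * r \<in> ?Z \<and> PP ^ a * s \<in> ?Z \<and> PP ^ b * s \<in> ?Z \<and> PP ^ b * t \<in> ?Z \<and>
        of_int \<gamma>\<^sub>1 * r + of_int \<gamma>\<^sub>2 * s \<in> ?Z \<and> of_int \<gamma>\<^sub>1 * s + of_int \<gamma>\<^sub>2 * t \<in> ?Z"
      using s t by simp
  qed
qed

lemma sym2_in_U_group_equal_iff:
  "sym2 r s t \<in> U_group (k + c) c c (int CARD('p) ^ c * h) \<gamma>\<^sub>1 \<gamma>\<^sub>2 \<longleftrightarrow>
    PP ^ (k + c) * r \<in> padic_integers \<and> PP ^ (k + c) * s \<in> padic_integers \<and>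
    PP ^ c * (of_int h * r + s) \<in> padic_integers \<and> PP ^ c * (of_int h * s + t) \<in> padic_integers \<and>
    PP ^ k * (of_int \<gamma>\<^sub>1 * r + of_int \<gamma>\<^sub>2 * s) \<in> padic_integers \<and>
    of_int \<gamma>\<^sub>1 * (of_int h * r + s) + of_int \<gamma>\<^sub>2 * (of_int h * s + t)
      \<in> (padic_integers :: 'p::prime_card padic set)"
proof -
  have "PP ^ (k + c) * (of_int \<gamma>\<^sub>1 * r + of_int \<gamma>\<^sub>2 * s) / PP ^ c = PP ^ k * (of_int \<gamma>\<^sub>1 * r + of_int \<gamma>\<^sub>2 * s)"
    by (simp add: power_add)
  moreover have "of_int (int CARD('p) ^ c * h) * x + PP ^ c * y = PP ^ c * (of_int h * x + y)" for x y :: "'p padic"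
    by (simp add: algebra_simps)
  moreover have "(of_int \<gamma>\<^sub>1 * (PP ^ c * x) + of_int \<gamma>\<^sub>2 * (PP ^ c * y)) / PP ^ c =
      of_int \<gamma>\<^sub>1 * x + of_int \<gamma>\<^sub>2 * y" for x y :: "'p padic"
    by (simp add: field_simps)
  ultimately show ?thesis
    unfolding sym2_in_U_group_iff min.idem by (simp only:)
qed

text \<open>Modulo \<open>p ^ c\<close> the conditions on the row vector become
  \<open>\<gamma>\<^sub>2\<close> times \<open>g r + s\<close> and times the form killing both
  generators. Nothing is assumed on \<open>g - h\<close>, so the lattice can serve to derive its
  coprimality to \<open>p\<close>.\<close>

lemma U_group_equal_iff_lattice:
  assumes \<gamma>: "\<not> int CARD('p::prime_card) dvd \<gamma>\<^sub>2" and g: "[\<gamma>\<^sub>2 * g = \<gamma>\<^sub>1] (mod int CARD('p) ^ c)"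
  shows "sym2 r s t \<in> U_group (k + c) c c (int CARD('p) ^ c * h) \<gamma>\<^sub>1 \<gamma>\<^sub>2 \<longleftrightarrow>
    padic_lattice k c g h r s (t :: 'p padic)"
proof -
  let ?p = "int CARD('p)" and ?Z = "padic_integers :: 'p padic set"
  obtain e where "\<gamma>\<^sub>2 * g - \<gamma>\<^sub>1 = ?p ^ c * e"
    using g by (auto simp: cong_iff_dvd_diff)
  then have "\<gamma>\<^sub>1 = \<gamma>\<^sub>2 * g - ?p ^ c * e" by simp
  then have e: "of_int \<gamma>\<^sub>1 = of_int \<gamma>\<^sub>2 * of_int g - PP ^ c * (of_int e :: 'p padic)" by simp
  let ?\<rho> = "of_int g * r + s" and ?\<zeta> = "of_int h * r + s"
    and ?\<eta> = "of_int (g * h) * r + of_int (g + h) * s + t"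
  show ?thesis
    unfolding sym2_in_U_group_equal_iff padic_lattice_def
  proof (intro iffI; elim conjE)
    assume U: "PP ^ (k + c) * r \<in> ?Z" "PP ^ (k + c) * s \<in> ?Z" "PP ^ c * ?\<zeta> \<in> ?Z"
      "PP ^ c * (of_int h * s + t) \<in> ?Z" "PP ^ k * (of_int \<gamma>\<^sub>1 * r + of_int \<gamma>\<^sub>2 * s) \<in> ?Z"
      "of_int \<gamma>\<^sub>1 * ?\<zeta> + of_int \<gamma>\<^sub>2 * (of_int h * s + t) \<in> ?Z"
    have "PP ^ c * (PP ^ k * ?\<rho>) \<in> ?Z"
      by (rule padic_integers_lincomb[OF U(1,2), of _ g 1]) (simp add: algebra_simps power_add)
    moreover have "of_int \<gamma>\<^sub>2 * (PP ^ k * ?\<rho>) \<in> ?Z"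
      by (rule padic_integers_lincomb[OF U(5,1), of _ 1 e]) (simp add: e algebra_simps power_add)
    ultimately have \<rho>: "PP ^ k * ?\<rho> \<in> ?Z"
      using \<gamma> by (rule padic_integers_cancel_coprime)
    have "PP ^ c * ?\<eta> \<in> ?Z"
      by (rule padic_integers_lincomb[OF U(4,3), of _ 1 g]) (simp add: algebra_simps)
    moreover have "of_int \<gamma>\<^sub>2 * ?\<eta> \<in> ?Z"
      by (rule padic_integers_lincomb[OF U(6,3), of _ 1 e]) (simp add: e algebra_simps)
    ultimately have "?\<eta> \<in> ?Z"
      using \<gamma> by (rule padic_integers_cancel_coprime)
    with \<rho> U show "PP ^ (k + c) * r \<in> ?Z \<and> PP ^ k * ?\<rho> \<in> ?Z \<and> PP ^ c * ?\<zeta> \<in> ?Z \<and> ?\<eta> \<in> ?Z"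
      by blast
  next
    assume L: "PP ^ (k + c) * r \<in> ?Z" "PP ^ k * ?\<rho> \<in> ?Z" "PP ^ c * ?\<zeta> \<in> ?Z" "?\<eta> \<in> ?Z"
    have "PP ^ (k + c) * s \<in> ?Z"
      by (rule padic_integers_lincomb[OF L(2,1), of _ "?p ^ c" "- g"]) (simp add: algebra_simps power_add)
    moreover have "PP ^ c * (of_int h * s + t) \<in> ?Z"
      by (rule padic_integers_lincomb[OF L(4,3), of _ "?p ^ c" "- g"]) (simp add: algebra_simps)
    moreover have "PP ^ k * (of_int \<gamma>\<^sub>1 * r + of_int \<gamma>\<^sub>2 * s) \<in> ?Z"
      by (rule padic_integers_lincomb[OF L(2,1), of _ \<gamma>\<^sub>2 "- e"]) (simp add: e algebra_simps power_add)
    moreover have "of_int \<gamma>\<^sub>1 * ?\<zeta> + of_int \<gamma>\<^sub>2 * (of_int h * s + t) \<in> ?Z"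
      by (rule padic_integers_lincomb[OF L(4,3), of _ \<gamma>\<^sub>2 "- e"]) (simp add: e algebra_simps)
    ultimately show "PP ^ (k + c) * r \<in> ?Z \<and> PP ^ (k + c) * s \<in> ?Z \<and> PP ^ c * ?\<zeta> \<in> ?Z \<and>
        PP ^ c * (of_int h * s + t) \<in> ?Z \<and> PP ^ k * (of_int \<gamma>\<^sub>1 * r + of_int \<gamma>\<^sub>2 * s) \<in> ?Z \<and>
        of_int \<gamma>\<^sub>1 * ?\<zeta> + of_int \<gamma>\<^sub>2 * (of_int h * s + t) \<in> ?Z"
      using L by blast
  qed
qed


section \<open>Test elements and necessary conditions\<close>

lemma of_int_div_PP_iff:
  "of_int i / PP \<in> (padic_integers :: 'p::prime_card padic set) \<longleftrightarrow> int CARD('p) dvd i"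
  using of_int_div_PP_power_iff[of i 1, where 'p='p] by simp

lemma trace_integralD:
  "\<lbrakk>trace_integral D U; sym2 r s t \<in> U\<rbrakk> \<Longrightarrow> t - of_int D * r \<in> padic_integers"
  by (simp add: trace_integral_def)

text \<open>For \<open>b > c\<close> the matrix diag(0, 1/p) is a member, with the non-integral
  value \<open>1 / p\<close>.\<close>

lemma trace_integral_U_group_b_le_c:
  assumes "trace_integral D (U_group a b c \<beta> \<gamma>\<^sub>1 \<gamma>\<^sub>2 :: ('p::prime_card padic ^ 2 ^ 2) set)"
  shows "b \<le> c"
proof (rule ccontr)
  assume "\<not> b \<le> c"
  then obtain d where b: "b = c + Suc d"
    by (metis add_Suc_right less_imp_Suc_add linorder_not_le)
  have "sym2 0 0 (1 / PP) \<in> (U_group a b c \<beta> \<gamma>\<^sub>1 \<gamma>\<^sub>2 :: ('p padic ^ 2 ^ 2) set)"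
    by (simp add: sym2_in_U_group_iff b power_add padic_integers_mult padic_integers_power)
  from trace_integralD[OF assms this] have "int CARD('p) dvd 1"
    unfolding of_int_div_PP_iff[symmetric] by simp
  then show False using not_prime_card_dvd_unit by blast
qed

text \<open>For \<open>b < c < a\<close> there is a member with upper left entry
  \<open>1 / p\<close> and all other entries integral, which would make \<open>D / p\<close>
  integral.\<close>

lemma trace_integral_U_group_a_le_c:
  assumes U: "trace_integral D (U_group a b c \<beta> \<gamma>\<^sub>1 \<gamma>\<^sub>2 :: ('p::prime_card padic ^ 2 ^ 2) set)"
    and \<beta>: "int CARD('p) ^ c dvd \<beta>" and D: "\<not> int CARD('p) dvd D" and "b < c"
  shows "a \<le> c"
proof (rule ccontr)
  assume "\<not> a \<le> c"
  then obtain e where a: "a = c + Suc e"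
    by (metis add_Suc_right less_imp_Suc_add linorder_not_le)
  obtain d where c: "c = b + Suc d"
    using \<open>b < c\<close> by (metis add_Suc_right less_imp_Suc_add)
  obtain h where h: "\<beta> = int CARD('p) ^ c * h" using \<beta> by blast
  have min: "min b c = b" using \<open>b < c\<close> by simp
  \<comment> \<open>\<open>s\<close> and \<open>t\<close> are solved from the requirement that
    \<open>u\<close> kill the second column of \<open>y\<close>; by \<open>\<beta> = p ^ c h\<close>
    and \<open>c = b + d + 1\<close> both are integral.\<close>
  let ?s = "- (PP ^ d * of_int h) :: 'p padic" and ?t = "PP ^ (2 * d + 1) * of_int h ^ 2 :: 'p padic"
  have Z: "PP ^ n * of_int x \<in> (padic_integers :: 'p padic set)" for n x
    by (intro padic_integers_mult padic_integers_power) simp_all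
  have "sym2 (1 / PP) ?s ?t \<in> U_group a b c \<beta> \<gamma>\<^sub>1 \<gamma>\<^sub>2"
    unfolding sym2_in_U_group_iff min
  proof (intro conjI)
    have z: "of_int \<beta> * (1 / PP) + PP ^ b * ?s = 0"
      by (simp add: h c power_add)
    have z': "of_int \<beta> * ?s + PP ^ b * ?t = 0"
      by (simp add: h c power_add power_mult power2_eq_square mult_ac)
    show "of_int \<beta> * (1 / PP) + PP ^ b * ?s \<in> padic_integers"
      "of_int \<beta> * ?s + PP ^ b * ?t \<in> padic_integers"
      "(of_int \<gamma>\<^sub>1 * (of_int \<beta> * (1 / PP) + PP ^ b * ?s) + of_int \<gamma>\<^sub>2 * (of_int \<beta> * ?s + PP ^ b * ?t)) / PP ^ b
        \<in> padic_integers"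
      unfolding z z' by simp_all
    have "PP ^ a * (1 / PP) = (PP ^ (c + e) * of_int 1 :: 'p padic)"
      by (simp add: a)
    then show "PP ^ a * (1 / PP) \<in> (padic_integers :: 'p padic set)"
      using Z by metis
    have "PP ^ a * ?s = PP ^ (a + d) * of_int (- h)"
      by (simp add: power_add)
    then show "PP ^ a * ?s \<in> padic_integers"
      using Z by metis
    have "PP ^ a * (of_int \<gamma>\<^sub>1 * (1 / PP) + of_int \<gamma>\<^sub>2 * ?s) / PP ^ c =
        PP ^ e * of_int \<gamma>\<^sub>1 - PP ^ (Suc e + d) * of_int (\<gamma>\<^sub>2 * h)"
      by (simp add: a power_add field_simps)
    then show "PP ^ a * (of_int \<gamma>\<^sub>1 * (1 / PP) + of_int \<gamma>\<^sub>2 * ?s) / PP ^ c \<in> padic_integers"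
      using padic_integers_diff[OF Z Z] by metis
  qed
  from trace_integralD[OF U this]
  have "PP ^ (2 * d + 1) * of_int (h\<^sup>2) - (?t - of_int D * (1 / PP)) \<in> padic_integers"
    by (rule padic_integers_diff[OF Z])
  then have "of_int D / PP \<in> (padic_integers :: 'p padic set)" by simp
  then show False using D by (simp add: of_int_div_PP_iff)
qed

lemma PP_power_div_PP: "0 < n \<Longrightarrow> PP ^ n / PP \<in> (padic_integers :: 'p::prime_card padic set)"
  by (cases n) (simp_all add: padic_integers_power)

text \<open>If \<open>p\<close> divides \<open>\<gamma>\<^sub>1\<close>, diag(1/p, 0) is a member
  with value \<open>- D / p\<close>. Otherwise the lattice criterion only has congruences modulo
  1.\<close>

lemma trace_integral_U_group_0_iff:
  fixes D \<gamma>\<^sub>1 :: int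
  assumes "\<not> int CARD('p::prime_card) dvd D" "0 < a"
  shows "trace_integral D (U_group a 0 a 0 \<gamma>\<^sub>1 0 :: ('p padic ^ 2 ^ 2) set) \<longleftrightarrow> \<not> int CARD('p) dvd \<gamma>\<^sub>1"
proof
  assume U: "trace_integral D (U_group a 0 a 0 \<gamma>\<^sub>1 0 :: ('p padic ^ 2 ^ 2) set)"
  show "\<not> int CARD('p) dvd \<gamma>\<^sub>1"
  proof
    assume "int CARD('p) dvd \<gamma>\<^sub>1"
    then have "sym2 (1 / PP) 0 0 \<in> (U_group a 0 a 0 \<gamma>\<^sub>1 0 :: ('p padic ^ 2 ^ 2) set)"
      using PP_power_div_PP[OF \<open>0 < a\<close>] by (simp add: sym2_in_U_group_iff of_int_div_PP_iff)
    from padic_integers_minus[OF trace_integralD[OF U this]] show False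
      using assms(1) by (simp add: of_int_div_PP_iff)
  qed
next
  assume "\<not> int CARD('p) dvd \<gamma>\<^sub>1"
  then show "trace_integral D (U_group a 0 a 0 \<gamma>\<^sub>1 0 :: ('p padic ^ 2 ^ 2) set)"
    by (subst U_group_lattice_trace_integral[OF U_group_0_iff_lattice])
      (simp_all add: not_prime_card_dvd_unit)
qed

text \<open>The test elements are diag(1/p, 0) and diag(0, 1/p), with values \<open>- D / p\<close>
  and \<open>1 / p\<close>.\<close>

lemma trace_integral_U_group_diag_coprime:
  assumes U: "trace_integral D (U_group a b a 0 \<gamma>\<^sub>1 \<gamma>\<^sub>2 :: ('p::prime_card padic ^ 2 ^ 2) set)"
    and D: "\<not> int CARD('p) dvd D" and b: "0 < b" "b \<le> a"
  shows "\<not> int CARD('p) dvd \<gamma>\<^sub>1" "\<not> int CARD('p) dvd \<gamma>\<^sub>2"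
proof -
  have min: "min b a = b" using b by simp
  have Z: "PP ^ a / PP \<in> (padic_integers :: 'p padic set)" "PP ^ b / PP \<in> (padic_integers :: 'p padic set)"
    using b by (simp_all add: PP_power_div_PP)
  show "\<not> int CARD('p) dvd \<gamma>\<^sub>1"
  proof
    assume "int CARD('p) dvd \<gamma>\<^sub>1"
    then have "sym2 (1 / PP) 0 0 \<in> (U_group a b a 0 \<gamma>\<^sub>1 \<gamma>\<^sub>2 :: ('p padic ^ 2 ^ 2) set)"
      using Z by (simp add: sym2_in_U_group_iff of_int_div_PP_iff)
    from padic_integers_minus[OF trace_integralD[OF U this]] show False
      using D by (simp add: of_int_div_PP_iff)
  qed
  show "\<not> int CARD('p) dvd \<gamma>\<^sub>2"
  proof
    assume "int CARD('p) dvd \<gamma>\<^sub>2"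
    then have "sym2 0 0 (1 / PP) \<in> (U_group a b a 0 \<gamma>\<^sub>1 \<gamma>\<^sub>2 :: ('p padic ^ 2 ^ 2) set)"
      using Z by (simp add: sym2_in_U_group_iff min of_int_div_PP_iff)
    from trace_integralD[OF U this] show False
      using of_int_div_PP_iff[of 1, where 'p='p] by (simp add: not_prime_card_dvd_unit)
  qed
qed

lemma trace_integral_U_group_equal_coprime:
  assumes U: "trace_integral D (U_group (k + c) c c (int CARD('p) ^ c * h) \<gamma>\<^sub>1 \<gamma>\<^sub>2 ::
      ('p::prime_card padic ^ 2 ^ 2) set)" (is "trace_integral D ?U")
    and D: "\<not> int CARD('p) dvd D" and pos: "0 < k" "0 < c"
  shows "\<not> int CARD('p) dvd \<gamma>\<^sub>1" "\<not> int CARD('p) dvd \<gamma>\<^sub>2"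
proof -
  have Z: "PP ^ k / PP \<in> (padic_integers :: 'p padic set)" "PP ^ c / PP \<in> (padic_integers :: 'p padic set)"
    "PP ^ (k + c) / PP \<in> (padic_integers :: 'p padic set)"
    using pos by (simp_all add: PP_power_div_PP)
  show "\<not> int CARD('p) dvd \<gamma>\<^sub>2"
  proof
    assume "int CARD('p) dvd \<gamma>\<^sub>2"
    then have "sym2 0 0 (1 / PP) \<in> ?U"
      using Z by (simp add: sym2_in_U_group_equal_iff of_int_div_PP_iff)
    from trace_integralD[OF U this] show False
      using of_int_div_PP_iff[of 1, where 'p='p] by (simp add: not_prime_card_dvd_unit)
  qed
  show "\<not> int CARD('p) dvd \<gamma>\<^sub>1"
  proof
    assume \<gamma>\<^sub>1: "int CARD('p) dvd \<gamma>\<^sub>1"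
    have \<gamma>\<^sub>1': "of_int \<gamma>\<^sub>1 / PP \<in> (padic_integers :: 'p padic set)"
      using \<gamma>\<^sub>1 by (simp add: of_int_div_PP_iff)
    \<comment> \<open>The last entry is chosen so that \<open>h s + t = 0\<close>; the value at this
      member is \<open>- h / p\<close>.\<close>
    have "sym2 0 (1 / PP) (- of_int h / PP) \<in> ?U"
      unfolding sym2_in_U_group_equal_iff
      using Z \<gamma>\<^sub>1' padic_integers_of_int_mult[OF Z(1), of \<gamma>\<^sub>2] by (simp add: mult_ac)
    from padic_integers_minus[OF trace_integralD[OF U this]]
    have h: "of_int h / PP \<in> (padic_integers :: 'p padic set)" by simp
    have "sym2 (1 / PP) 0 0 \<in> ?U"
      unfolding sym2_in_U_group_equal_iff
      using Z h padic_integers_of_int_mult[OF Z(1), of \<gamma>\<^sub>1] padic_integers_of_int_mult[OF Z(2), of h]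
        padic_integers_of_int_mult[OF h, of \<gamma>\<^sub>1] by (simp add: mult_ac)
    from padic_integers_minus[OF trace_integralD[OF U this]] show False
      using D by (simp add: of_int_div_PP_iff)
  qed
qed

text \<open>The witness has \<open>r = 0\<close>; its \<open>s\<close> has the largest denominator
  that both \<open>p ^ k\<close> and \<open>p ^ c\<close> clear, and \<open>t = - (g + h) s\<close>
  makes the last form vanish.\<close>

lemma trace_integral_padic_lattice_dvd_add:
  assumes "\<And>r s t :: 'p::prime_card padic. padic_lattice k c g h r s t \<Longrightarrow> t - of_int D * r \<in> padic_integers"
  shows "int CARD('p) ^ min k c dvd h + g"
proof -
  let ?m = "min k c"
  have Z: "PP ^ n / PP ^ ?m \<in> (padic_integers :: 'p padic set)" if "?m \<le> n" for n
    using that by (simp add: power_diff[symmetric] padic_integers_power)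
  have "padic_lattice k c g h 0 (1 / PP ^ ?m) (- (of_int (h + g) / PP ^ ?m) :: 'p padic)"
    using Z[of k] Z[of c] by (simp add: padic_lattice_def add_divide_distrib[symmetric] add.commute)
  from padic_integers_minus[OF assms[OF this]] show ?thesis
    unfolding of_int_div_PP_power_iff[symmetric, where 'p='p] by simp
qed

text \<open>The order matters: coprimality of the \<open>\<gamma>\<close>s identifies
  \<open>U_group\<close> with the lattice, the lattice forces \<open>h + g = 0\<close> modulo
  \<open>p ^ min k c\<close>, and this yields the coprimality of \<open>g - h\<close> to
  \<open>p\<close> on which the criterion and the measure rest.\<close>

lemma trace_integral_U_group_equal_iff:
  assumes D: "\<not> int CARD('p::prime_card) dvd 2 * D" and pos: "0 < k" "0 < c"
    and g: "\<not> int CARD('p) dvd \<gamma>\<^sub>2 \<Longrightarrow> [\<gamma>\<^sub>2 * g = \<gamma>\<^sub>1] (mod int CARD('p) ^ c)"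
  shows "trace_integral D (U_group (k + c) c c (int CARD('p) ^ c * h) \<gamma>\<^sub>1 \<gamma>\<^sub>2 :: ('p padic ^ 2 ^ 2) set) \<longleftrightarrow>
      \<not> int CARD('p) dvd \<gamma>\<^sub>1 \<and> \<not> int CARD('p) dvd \<gamma>\<^sub>2 \<and>
      [g\<^sup>2 = D] (mod int CARD('p) ^ c) \<and> [h\<^sup>2 = D] (mod int CARD('p) ^ k) \<and>
      [h + g = 0] (mod int CARD('p) ^ min k c)"
    and "\<lbrakk>trace_integral D (U_group (k + c) c c (int CARD('p) ^ c * h) \<gamma>\<^sub>1 \<gamma>\<^sub>2 :: ('p padic ^ 2 ^ 2) set);
      normalized_haar \<mu>\<rbrakk> \<Longrightarrow>
      measure \<mu> (U_group (k + c) c c (int CARD('p) ^ c * h) \<gamma>\<^sub>1 \<gamma>\<^sub>2 :: ('p padic ^ 2 ^ 2) set) =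
        real CARD('p) ^ (k + c)"
proof -
  let ?p = "int CARD('p)"
  let ?U = "U_group (k + c) c c (?p ^ c * h) \<gamma>\<^sub>1 \<gamma>\<^sub>2 :: ('p padic ^ 2 ^ 2) set"
  let ?T = "trace_integral D ?U"
  have p: "prime ?p" using prime_card[where 'a='p] by simp
  \<comment> \<open>As \<open>h\<close> is \<open>- g\<close> modulo \<open>p\<close>, divisibility
    of \<open>g - h\<close> would pass to \<open>2 g\<close>, to \<open>g\<close> since
    \<open>p\<close> is odd, and then to \<open>\<gamma>\<^sub>1\<close>.\<close>
  have not_dvd: "\<not> ?p dvd g - h"
    if "\<not> ?p dvd \<gamma>\<^sub>1" "\<not> ?p dvd \<gamma>\<^sub>2" "?p ^ min k c dvd h + g"
  proof
    assume "?p dvd g - h"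
    moreover have "?p dvd h + g"
      using that(3) pos by (metis dvd_power dvd_trans min_less_iff_conj)
    ultimately have "?p dvd (g - h) + (h + g)" by (rule dvd_add)
    then have "?p dvd 2 * g" by simp
    then have "?p dvd g"
      using D p by (auto simp: prime_dvd_mult_iff)
    moreover have "?p dvd \<gamma>\<^sub>2 * g - \<gamma>\<^sub>1"
      using g[OF that(2)] pos by (meson cong_iff_dvd_diff dvd_power dvd_trans)
    ultimately have "?p dvd \<gamma>\<^sub>1"
      using dvd_diff[OF dvd_mult[of ?p g \<gamma>\<^sub>2], of "\<gamma>\<^sub>2 * g - \<gamma>\<^sub>1"] by simp
    then show False using that(1) by simp
  qed
  have necessary: "\<not> ?p dvd \<gamma>\<^sub>1 \<and> \<not> ?p dvd \<gamma>\<^sub>2 \<and> ?p ^ min k c dvd h + g" if T: ?T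
  proof -
    have "\<not> ?p dvd D" using D by auto
    note \<gamma> = trace_integral_U_group_equal_coprime[OF T this pos]
    have "?p ^ min k c dvd h + g"
    proof (rule trace_integral_padic_lattice_dvd_add)
      fix r s t :: "'p padic" assume "padic_lattice k c g h r s t"
      then have "sym2 r s t \<in> ?U"
        by (simp only: U_group_equal_iff_lattice[OF \<gamma>(2) g[OF \<gamma>(2)]])
      with T show "t - of_int D * r \<in> padic_integers" by (rule trace_integralD)
    qed
    with \<gamma> show ?thesis by simp
  qed
  have lattice: "?T \<longleftrightarrow> [h\<^sup>2 = D] (mod ?p ^ k) \<and> [g\<^sup>2 = D] (mod ?p ^ c)"
      "normalized_haar \<mu> \<Longrightarrow> measure \<mu> ?U = real CARD('p) ^ (k + c)"
    if "\<not> ?p dvd \<gamma>\<^sub>1" "\<not> ?p dvd \<gamma>\<^sub>2" "?p ^ min k c dvd h + g"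
    using U_group_lattice_trace_integral[OF U_group_equal_iff_lattice[OF that(2) g[OF that(2)]] not_dvd[OF that]]
      U_group_lattice_measure[OF U_group_equal_iff_lattice[OF that(2) g[OF that(2)]] not_dvd[OF that]]
    by blast+
  show "?T \<longleftrightarrow> \<not> ?p dvd \<gamma>\<^sub>1 \<and> \<not> ?p dvd \<gamma>\<^sub>2 \<and> [g\<^sup>2 = D] (mod ?p ^ c) \<and>
      [h\<^sup>2 = D] (mod ?p ^ k) \<and> [h + g = 0] (mod ?p ^ min k c)"
    using necessary lattice(1) by (auto simp: cong_0_iff)
  show "\<lbrakk>?T; normalized_haar \<mu>\<rbrakk> \<Longrightarrow> measure \<mu> ?U = real CARD('p) ^ (k + c)"
    using necessary lattice(2) by blast
qed

text \<open>With \<open>x\<close> as \<open>\<gamma>\<^sub>2\<close> and \<open>y\<close> as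
  \<open>\<gamma>\<^sub>1\<close>, this is the division-free description of \<open>g\<close> used
  for the lattices.\<close>

lemma coprime_modular_inverse_cong:
  assumes "prime p" "\<not> p dvd x"
  shows "[x * (y * modular_inverse (p ^ n) x) = y] (mod (p ^ n :: int))"
proof -
  have "coprime (p ^ n) x"
    using assms by (simp add: prime_imp_coprime)
  then have "[x * modular_inverse (p ^ n) x = 1] (mod p ^ n)"
    by (simp add: cong_modular_inverse1 coprime_commute)
  from cong_mult[OF cong_refl[of y] this] show ?thesis
    by (simp add: mult_ac)
qed


section \<open>Assembly of the cases\<close>

lemma gcd_prime_eq_1_iff:
  assumes "prime (p :: int)"
  shows "gcd x p = 1 \<longleftrightarrow> \<not> p dvd x"
  using assms by (metis coprime_iff_gcd_eq_1 gcd.commute not_prime_unit prime_imp_coprime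
      coprime_common_divisor dvd_refl)

theorem theorem3p13:
  fixes p :: int and D :: int
    and \<psi> :: "'p::prime_card padic \<Rightarrow> complex"
    and \<mu> :: "('p padic ^ 2 ^ 2) measure"
    and a b c :: nat and \<beta> \<gamma>\<^sub>1 \<gamma>\<^sub>2 :: int
    and m :: "'p padic ^ 3 ^ 3" and B :: real
  assumes "p = int CARD('p)"
    and "\<not> p dvd 2 * D"
    and "splits_in_quadratic_field CARD('p) D"
    and "unramified_character \<psi>"
    and "normalized_haar \<mu>"
    and "M_range p a b c \<beta> \<gamma>\<^sub>1 \<gamma>\<^sub>2"
    and "m = M_matrix a b c \<beta> \<gamma>\<^sub>1 \<gamma>\<^sub>2"
    and "B = cumulative_measure \<mu> a b c \<beta> \<gamma>\<^sub>1 \<gamma>\<^sub>2"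
  shows
    "(b = 0 \<and> c = 0 \<longrightarrow>
       (admissible D \<psi> m \<longleftrightarrow>
          m = M_matrix a 0 0 \<beta> \<gamma>\<^sub>1 0 \<and> [\<beta>\<^sup>2 = D] (mod p ^ a)) \<and>
       (admissible D \<psi> m \<longrightarrow> B = of_int p ^ a)) \<and>
     (b = 0 \<and> a = c \<and> a \<ge> 1 \<longrightarrow>
       (admissible D \<psi> m \<longleftrightarrow>
          m = M_matrix a 0 a 0 \<gamma>\<^sub>1 0 \<and> \<not> p dvd \<gamma>\<^sub>1) \<and>
       (admissible D \<psi> m \<longrightarrow> B = of_int p ^ (2 * a))) \<and>
     (a = c \<and> c \<ge> b \<and> b \<ge> 1 \<longrightarrow>
       (admissible D \<psi> m \<longleftrightarrow>
          m = M_matrix a b a 0 \<gamma>\<^sub>1 \<gamma>\<^sub>2 \<and> gcd \<gamma>\<^sub>1 p = 1 \<and> gcd \<gamma>\<^sub>2 p = 1 \<and>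
          [(\<gamma>\<^sub>1 * modular_inverse (p ^ b) \<gamma>\<^sub>2)\<^sup>2 = D] (mod p ^ b)) \<and>
       (admissible D \<psi> m \<longrightarrow> B = of_int p ^ (2 * a + 2 * b))) \<and>
     (a > c \<and> c = b \<and> b \<ge> 1 \<longrightarrow>
       (let \<beta>' = \<beta> div p ^ c in
        (admissible D \<psi> m \<longleftrightarrow>
          m = M_matrix a c c \<beta> \<gamma>\<^sub>1 \<gamma>\<^sub>2 \<and> p ^ c dvd \<beta> \<and> gcd \<gamma>\<^sub>1 p = 1 \<and> gcd \<gamma>\<^sub>2 p = 1 \<and>
          [(\<gamma>\<^sub>1 * modular_inverse (p ^ c) \<gamma>\<^sub>2)\<^sup>2 = D] (mod p ^ c) \<and>
          [\<beta>'\<^sup>2 = D] (mod p ^ (a - c)) \<and>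
          [\<beta>' + \<gamma>\<^sub>1 * modular_inverse (p ^ c) \<gamma>\<^sub>2 = 0] (mod p ^ min (a - c) c)) \<and>
        (admissible D \<psi> m \<longrightarrow> B = of_int p ^ (a + 3 * c)))) \<and>
     (admissible D \<psi> m \<longrightarrow>
       (b = 0 \<and> c = 0) \<or> (b = 0 \<and> a = c \<and> a \<ge> 1) \<or>
       (a = c \<and> c \<ge> b \<and> b \<ge> 1) \<or> (a > c \<and> c = b \<and> b \<ge> 1))"
proof -
  have p: "prime p" and p_eq: "int CARD('p) = p"
    using assms(1) prime_card[where 'a='p] by simp_all
  have D: "\<not> p dvd D" "\<not> p dvd 2 * D"
    using assms(2) by auto
  let ?U = "U_group a b c \<beta> \<gamma>\<^sub>1 \<gamma>\<^sub>2 :: ('p padic ^ 2 ^ 2) set"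
  have adm: "admissible D \<psi> m \<longleftrightarrow> trace_integral D ?U"
    unfolding assms(7) by (rule admissible_M_matrix_iff) (use assms(1,4,6) in auto)
  have B: "B = of_int p ^ (2 * c + min b c) * measure \<mu> ?U"
    by (simp add: assms(1,8) cumulative_measure_def)
  note M = assms(6)[unfolded M_range_def]
  have \<gamma>\<^sub>2_0: "\<gamma>\<^sub>2 = 0" if "b = 0"
    using M that by simp
  \<comment> \<open>\<open>p ^ a\<close> divides \<beta>, which lies below
    \<open>p ^ a\<close>.\<close>
  have \<beta>_0: "\<beta> = 0" if "a = c"
    using M that by (auto dest: zdvd_imp_le)
  have 1: "admissible D \<psi> m \<longleftrightarrow> [\<beta>\<^sup>2 = D] (mod p ^ a)" "B = of_int p ^ a"
    if "b = 0" "c = 0"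
  proof -
    \<comment> \<open>Lattice with \<open>k = 0\<close>, \<open>n = a\<close>,
      \<open>g = \<beta>\<close>, \<open>h = \<beta> + 1\<close>, so that
      \<open>g - h = -1\<close>.\<close>
    note lattice = U_group_00_iff_lattice[where 'p='p, of _ _ _ a \<beta> \<gamma>\<^sub>1]
    have unit: "\<not> int CARD('p) dvd \<beta> - (\<beta> + 1)"
      using not_prime_card_dvd_unit[where 'p='p] by simp
    show "admissible D \<psi> m \<longleftrightarrow> [\<beta>\<^sup>2 = D] (mod p ^ a)"
      using U_group_lattice_trace_integral[OF lattice unit, of D]
      by (simp add: adm that \<gamma>\<^sub>2_0 p_eq)
    show "B = of_int p ^ a"
      using U_group_lattice_measure[OF lattice unit assms(5)]
      by (simp add: B that \<gamma>\<^sub>2_0 assms(1))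
  qed
  have 2: "admissible D \<psi> m \<longleftrightarrow> \<not> p dvd \<gamma>\<^sub>1" "admissible D \<psi> m \<longrightarrow> B = of_int p ^ (2 * a)"
    if "b = 0" "a = c" "a \<ge> 1"
  proof -
    have zeros: "\<beta> = 0" "\<gamma>\<^sub>2 = 0" using \<beta>_0 \<gamma>\<^sub>2_0 that by auto
    show iff: "admissible D \<psi> m \<longleftrightarrow> \<not> p dvd \<gamma>\<^sub>1"
      using trace_integral_U_group_0_iff[where 'p='p, of D a \<gamma>\<^sub>1] D that
      by (simp add: adm zeros p_eq)
    show "admissible D \<psi> m \<longrightarrow> B = of_int p ^ (2 * a)"
    proof
      assume "admissible D \<psi> m"
      then have "\<not> int CARD('p) dvd \<gamma>\<^sub>1" using iff by (simp add: p_eq)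
      \<comment> \<open>Lattice with \<open>k = n = 0\<close>: the measure is 1 and only the factor
        \<open>p ^ (2 * c)\<close> is left.\<close>
      note lattice = U_group_0_iff_lattice[OF this, of _ _ _ a]
      have "\<not> int CARD('p) dvd 0 - 1"
        using not_prime_card_dvd_unit[where 'p='p] by simp
      from U_group_lattice_measure[OF lattice this assms(5)] show "B = of_int p ^ (2 * a)"
        using that by (simp add: B zeros)
    qed
  qed
  have 3: "admissible D \<psi> m \<longleftrightarrow> \<not> p dvd \<gamma>\<^sub>1 \<and> \<not> p dvd \<gamma>\<^sub>2 \<and>
        [(\<gamma>\<^sub>1 * modular_inverse (p ^ b) \<gamma>\<^sub>2)\<^sup>2 = D] (mod p ^ b)"
      "admissible D \<psi> m \<longrightarrow> B = of_int p ^ (2 * a + 2 * b)"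
    if "a = c" "c \<ge> b" "b \<ge> 1"
  proof -
    let ?g = "\<gamma>\<^sub>1 * modular_inverse (p ^ b) \<gamma>\<^sub>2"
    have \<beta>: "\<beta> = 0" using \<beta>_0 that by simp
    have unit: "\<not> int CARD('p) dvd ?g - (?g + 1)"
      using not_prime_card_dvd_unit[where 'p='p] by simp
    have lattice: "sym2 r s t \<in> U_group a b a 0 \<gamma>\<^sub>1 \<gamma>\<^sub>2 \<longleftrightarrow> padic_lattice 0 b ?g (?g + 1) r s (t :: 'p padic)"
      if "\<not> p dvd \<gamma>\<^sub>1" "\<not> p dvd \<gamma>\<^sub>2" for r s t
      using that \<open>a = c\<close> \<open>c \<ge> b\<close> coprime_modular_inverse_cong[OF p]
      by (intro U_group_diag_iff_lattice) (simp_all add: p_eq)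
    have coprime: "\<not> p dvd \<gamma>\<^sub>1 \<and> \<not> p dvd \<gamma>\<^sub>2" if "admissible D \<psi> m"
      using trace_integral_U_group_diag_coprime[where 'p='p, of D a b \<gamma>\<^sub>1 \<gamma>\<^sub>2] D that
        \<open>a = c\<close> \<open>c \<ge> b\<close> \<open>b \<ge> 1\<close> by (simp add: adm \<beta> p_eq)
    show "admissible D \<psi> m \<longleftrightarrow> \<not> p dvd \<gamma>\<^sub>1 \<and> \<not> p dvd \<gamma>\<^sub>2 \<and> [?g\<^sup>2 = D] (mod p ^ b)"
      using coprime U_group_lattice_trace_integral[OF lattice unit, of D] \<open>a = c\<close>
      by (auto simp: adm \<beta> p_eq)
    show "admissible D \<psi> m \<longrightarrow> B = of_int p ^ (2 * a + 2 * b)"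
    proof
      assume "admissible D \<psi> m"
      then have "measure \<mu> ?U = of_int p ^ b"
        using coprime U_group_lattice_measure[OF lattice unit assms(5)] \<open>a = c\<close>
        by (simp add: \<beta> assms(1))
      \<comment> \<open>The factor in front has exponent \<open>2 a + b\<close>, and the index
        contributes another \<open>b\<close>.\<close>
      then show "B = of_int p ^ (2 * a + 2 * b)"
        using that by (simp add: B power_add[symmetric] min_absorb1 mult_2 add.assoc)
    qed
  qed
  have 4: "admissible D \<psi> m \<longleftrightarrow> \<not> p dvd \<gamma>\<^sub>1 \<and> \<not> p dvd \<gamma>\<^sub>2 \<and>
        [(\<gamma>\<^sub>1 * modular_inverse (p ^ c) \<gamma>\<^sub>2)\<^sup>2 = D] (mod p ^ c) \<and>
        [(\<beta> div p ^ c)\<^sup>2 = D] (mod p ^ (a - c)) \<and>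
        [\<beta> div p ^ c + \<gamma>\<^sub>1 * modular_inverse (p ^ c) \<gamma>\<^sub>2 = 0] (mod p ^ min (a - c) c)"
      "admissible D \<psi> m \<longrightarrow> B = of_int p ^ (a + 3 * c)"
    if "a > c" "c = b" "b \<ge> 1"
  proof -
    let ?g = "\<gamma>\<^sub>1 * modular_inverse (p ^ c) \<gamma>\<^sub>2"
    define k where "k = a - c"
    define h where "h = \<beta> div p ^ c"
    have k: "0 < k" "0 < c" "a = k + c" using that by (simp_all add: k_def)
    have \<beta>: "\<beta> = p ^ c * h" using M by (simp add: h_def)
    have g: "\<not> int CARD('p) dvd \<gamma>\<^sub>2 \<Longrightarrow> [\<gamma>\<^sub>2 * ?g = \<gamma>\<^sub>1] (mod int CARD('p) ^ c)"
      using coprime_modular_inverse_cong[OF p] by (simp add: p_eq)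
    have D': "\<not> int CARD('p) dvd 2 * D" using D by (simp add: p_eq)
    have U: "?U = U_group (k + c) c c (int CARD('p) ^ c * h) \<gamma>\<^sub>1 \<gamma>\<^sub>2"
      using that by (simp add: k \<beta> p_eq)
    show "admissible D \<psi> m \<longleftrightarrow> \<not> p dvd \<gamma>\<^sub>1 \<and> \<not> p dvd \<gamma>\<^sub>2 \<and> [?g\<^sup>2 = D] (mod p ^ c) \<and>
        [(\<beta> div p ^ c)\<^sup>2 = D] (mod p ^ (a - c)) \<and>
        [\<beta> div p ^ c + ?g = 0] (mod p ^ min (a - c) c)"
      using trace_integral_U_group_equal_iff(1)[OF D' k(1,2) g, of h]
      unfolding adm U p_eq k_def[symmetric] h_def[symmetric] .
    show "admissible D \<psi> m \<longrightarrow> B = of_int p ^ (a + 3 * c)"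
    proof
      assume "admissible D \<psi> m"
      then have "measure \<mu> ?U = of_int p ^ (k + c)"
        using trace_integral_U_group_equal_iff(2)[OF D' k(1,2) g _ assms(5), of h]
        unfolding adm U by (simp add: assms(1))
      \<comment> \<open>The factor in front has exponent \<open>3 c\<close>, and the index
        contributes \<open>k + c = a\<close>.\<close>
      then show "B = of_int p ^ (a + 3 * c)"
        using that by (simp add: B k(3) power_add[symmetric] algebra_simps)
    qed
  qed
  have 5: "(b = 0 \<and> c = 0) \<or> (b = 0 \<and> a = c \<and> a \<ge> 1) \<or>
      (a = c \<and> c \<ge> b \<and> b \<ge> 1) \<or> (a > c \<and> c = b \<and> b \<ge> 1)" if "admissible D \<psi> m"
  proof -
    have T: "trace_integral D ?U" using that adm by simp
    \<comment> \<open>The inequalities \<open>b \<le> c \<le> a\<close>, with \<open>a = c\<close>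
      whenever \<open>b < c\<close>, leave only the four shapes.\<close>
    have "b \<le> c" using T by (rule trace_integral_U_group_b_le_c)
    moreover have "a \<le> c" if "b < c"
      using T _ _ that by (rule trace_integral_U_group_a_le_c) (use M D in \<open>simp_all add: p_eq\<close>)
    moreover have "c \<le> a" using M by simp
    ultimately show ?thesis by linarith
  qed
  note gcd_iff = gcd_prime_eq_1_iff[OF p]
  show ?thesis
    unfolding Let_def gcd_iff
    using 1 2 3 4 5 M \<beta>_0 \<gamma>\<^sub>2_0 assms(7) by (intro conjI impI) (elim conjE; simp)+
qed

end
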